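(* Let $p$ and $q_1,\dots,q_m$ be hermitian polynomials in $\mathbb{K}[x,x^*]$ such that problem $\mathbf{P}$ (defined in the context) is feasible and the quadratic module $\mathbf{M}_Q$ of $Q=\{q_1,\dots,q_m\}$ is Archimedean. Let $d_i=\lceil\deg(q_i)/2\rceil$ and suppose $d=\max_i d_i\ge1$. Let $2k\ge\max\{\deg(p),\max_i\deg(q_i)\}$ and assume that $y^k$ is an optimal solution of the relaxation $\mathbf{R}_k$, with optimal value $p^k$, satisfying $$\operatorname{rank}M_k(y^k)=\operatorname{rank}M_{k-d}(y^k).$$ Then $p^k=p^\star$, i.e. the optimum of the relaxation of order $k$ is the global optimum of $\mathbf{P}$. Moreover, there exists a global optimizer $(H^\star,X^\star,\phi^\star)$ of $\mathbf{P}$ with $\dim H^\star=\operatorname{rank}M_{k-d}(y^k)$.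
   Context: Let $\mathbb{K}\in\{\mathbb{R},\mathbb{C}\}$. $\mathbb{K}[x,x^*]$ is the free $*$-algebra of polynomials in the $2n$ non-commuting variables $x_1,\dots,x_n,x_1^*,\dots,x_n^*$; we also write $x_{n+i}=x_i^*$ (so $x_{n+i}^*=x_i$). Its elements are finite sums $p=\sum_w p_w w$ with $p_w\in\mathbb{K}$ and $w$ ranging over words in the $2n$ letters; the empty word is denoted $1$. The involution $*$ satisfies $(x_i)^*=x_i^*$, $(x_i^* )^*=x_i$, reverses words ($(w_1\cdots w_l)^*=w_l^*\cdots w_1^*$) and conjugates coefficients. $p$ is hermitian if $p^*=p$. $|w|$ is the length of a word, $\deg(p)$ the length of the longest word in $p$, and $\mathcal{W}_d$ the set of words of length at most $d$. For a Hilbert space $H$ over $\mathbb{K}$ and bounded operators $X=(X_1,\dots,X_n)$ on $H$, $p(X)$ is obtained by substituting $X_i$ for $x_i$ and the adjoint $X_i^*$ for $x_i^*$. $O\succeq0$ means $O$ is hermitian (self-adjoint) and $\langle\phi,O\phi\rangle\ge0$ for all $\phi$. Problem $\mathbf{P}$: $p^\star=\min_{(H,X,\phi)}\langle\phi,p(X)\phi\rangle$ subject to $q_i(X)\succeq0$, $i=1,\dots,m$, over all Hilbert spaces $H$ over $\mathbb{K}$ (of arbitrary dimension), all $n$-tuples $X$ of bounded operators on $H$ and all unit vectors $\phi\in H$. A global optimizer is a feasible triple attaining the value $p^\star$. The quadratic module $\mathbf{M}_Q$ is the set of all finite sums $\sum_i f_i^*f_i+\sum_i\sum_j g_{ij}^*q_ig_{ij}$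 with $f_i,g_{ij}\in\mathbb{K}[x,x^*]$. It is Archimedean if there is a real constant $C$ with $C^2-(x_1^*x_1+\cdots+x_{2n}^*x_{2n})\in\mathbf{M}_Q$. For $y=(y_w)_{|w|\le 2k}$ with $y_w\in\mathbb{K}$, put $L_y(f)=\sum_w f_wy_w$ for polynomials $f$ of degree at most $2k$. For $j\le k$ the moment matrix $M_j(y)$ is indexed by $\mathcal{W}_j$ with entries $M_j(y)(v,w)=L_y(v^*w)=y_{v^*w}$. For a polynomial $q=\sum_u q_u u$, the localizing matrix $M_j(qy)$ is indexed by $\mathcal{W}_j$ with entries $M_j(qy)(v,w)=L_y(v^*qw)=\sum_u q_uy_{v^*uw}$. For $2k\ge\max\{\deg(p),\max_i\deg(q_i)\}$ the relaxation $\mathbf{R}_k$ is: $p^k=\min_y\sum_w p_wy_w$ over $y=(y_w)_{|w|\le2k}\in\mathbb{K}^{|\mathcal{W}_{2k}|}$ subject to $y_1=1$, $M_k(y)\succeq0$, and $M_{k-d_i}(q_iy)\succeq0$ for $i=1,\dots,m$. Optimal values "min" are understood as infima (attainment not presupposed). *)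

theory Defs
  imports
    "HOL-Analysis.Analysis"
    "HOL-Library.Poly_Mapping"
    "HOL-Library.Equipollence"
    "Jordan_Normal_Form.Conjugate"
    "Jordan_Normal_Form.DL_Rank"
begin

section \<open>The scalar field\<close>

text \<open>
  The type class below has, up to isomorphism, exactly two members: the real numbers with trivial
  conjugation and the complex numbers with complex conjugation. Both are instances, and lemma
  \<open>real_or_complex_cases\<close> shows that there are no others. On the complex numbers, \<open>0 \<le> z\<close> means
  that \<open>z\<close> is a nonnegative real.
\<close>

class real_or_complex = real_normed_field + conjugatable_ordered_field +
  fixes real_part :: "'a \<Rightarrow> real"
  assumes real_part_scaleR: "real_part z *\<^sub>R 1 = (z + conjugate z) / 2"
    and mult_conjugate_scaleR: "z * conjugate z = (norm z)\<^sup>2 *\<^sub>R 1"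
    and zero_le_iff_scaleR: "0 \<le> z \<longleftrightarrow> (\<exists>r\<ge>0. z = r *\<^sub>R 1)"

lemma of_real_real_part: "of_real (real_part z) = (z + conjugate z) / (2 :: 'a::real_or_complex)"
  by (simp add: of_real_def real_part_scaleR)

lemma mult_conjugate_norm:
  "z * conjugate z = (of_real ((norm z)\<^sup>2) :: 'a::real_or_complex)"
  by (simp add: of_real_def mult_conjugate_scaleR)

instantiation real :: real_or_complex
begin

definition "real_part (x::real) = x"

instance
  by standard (auto simp: real_part_real_def power2_eq_square)

end

instantiation complex :: real_or_complex
begin

definition "real_part (z::complex) = Re z"

instance
proof
  fix z :: complex
  show "real_part z *\<^sub>R 1 = (z + conjugate z) / 2"
    by (simp add: real_part_complex_def complex_eq_iff)
  show "z * conjugate z = (norm z)\<^sup>2 *\<^sub>R 1"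
    using complex_norm_square[of z] by (simp add: scaleR_conv_of_real)
  show "(0 \<le> z) = (\<exists>r\<ge>0. z = r *\<^sub>R 1)"
    by (auto simp: less_eq_complex_def complex_eq_iff)
qed

end

lemma conjugate_of_real:
  "conjugate (of_real r :: 'a::real_or_complex) = of_real r"
proof (cases "r = 0")
  case False
  have "(of_real r :: 'a) * conjugate (of_real r) = of_real r * of_real r"
    using mult_conjugate_norm[of "of_real r :: 'a"]
    by (simp add: power2_eq_square flip: of_real_mult)
  with False show ?thesis
    by simp
qed simp

lemma real_or_complex_cases:
  "(\<forall>z::'a::real_or_complex. conjugate z = z \<and> z = of_real (real_part z)) \<or>
   (\<exists>i::'a. i * i = -1 \<and> conjugate i = - i \<and> (\<forall>z. \<exists>a b. z = of_real a + of_real b * i))"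
proof (cases "\<forall>z::'a. conjugate z = z")
  case True
  then show ?thesis
    by (simp add: of_real_real_part)
next
  case False
  then obtain w :: 'a where w: "conjugate w \<noteq> w"
    by blast
  define u where "u = w - conjugate w"
  have sub: "conjugate (a - b) = conjugate a - conjugate b" for a b :: 'a
    using conjugate_dist_add[of a "- b"] by (simp add: conjugate_neg)
  have u0: "u \<noteq> 0" and cu: "conjugate u = - u"
    using w by (auto simp: u_def sub)
  define i where "i = of_real (inverse (norm u)) * u"
  have ci: "conjugate i = - i"
    by (simp only: i_def conjugate_dist_mul conjugate_of_real cu) simp
  have "i * conjugate i = of_real ((norm i)\<^sup>2)"
    by (rule mult_conjugate_norm)
  moreover have "norm i = 1"
    using u0 by (simp add: i_def norm_mult norm_inverse)
  ultimately have ii: "i * i = -1"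
    using ci by (metis minus_minus mult_minus_right of_real_1 one_power2)
  have "\<exists>a b. z = of_real a + of_real b * i" for z :: 'a
  proof -
    define v where "v = (conjugate z - z) * i"
    have "conjugate v = v"
      by (simp add: v_def conjugate_dist_mul sub ci algebra_simps)
    then have v: "v = of_real (real_part v)"
      by (simp add: of_real_real_part)
    have "v * i = z - conjugate z"
    proof -
      have "v * i = (conjugate z - z) * (i * i)"
        by (simp add: v_def mult.assoc)
      then show ?thesis
        by (simp add: ii)
    qed
    moreover have "2 * of_real (real_part z) = z + conjugate z"
      by (simp add: of_real_real_part)
    ultimately have "2 * z = 2 * of_real (real_part z) + v * i"
      by simp
    then have "z = of_real (real_part z) + v / 2 * i"
      by (simp add: field_simps)
    also have "v / 2 = of_real (real_part v / 2)"
      using v by simp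
    finally show ?thesis
      by blast
  qed
  with ii ci show ?thesis
    by blast
qed


section \<open>Non-commutative polynomials\<close>

datatype 'n letter = Var 'n | VarStar 'n

instance letter :: (finite) finite
proof
  have "(UNIV :: 'a letter set) \<subseteq> range Var \<union> range VarStar"
  proof
    show "x \<in> range Var \<union> range VarStar" for x :: "'a letter"
      by (cases x) auto
  qed
  moreover have "finite (range Var \<union> range VarStar :: 'a letter set)"
    by simp
  ultimately show "finite (UNIV :: 'a letter set)"
    by (rule finite_subset)
qed

type_synonym 'n ncword = "'n letter list"

text \<open>
  Lists form a monoid under concatenation. Written additively, this makes the convolution product
  of finitely supported functions on lists the product of the free algebra.
\<close>

instantiation list :: (type) monoid_add
begin

definition zero_list :: "'a list" where "zero_list = []"

definition plus_list :: "'a list \<Rightarrow> 'a list \<Rightarrow> 'a list" where "plus_list = (@)"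

instance
  by standard (simp_all add: zero_list_def plus_list_def)

end

type_synonym ('n, 'k) ncpoly = "'n ncword \<Rightarrow>\<^sub>0 'k"

fun letter_star :: "'n letter \<Rightarrow> 'n letter" where
  "letter_star (Var i) = VarStar i"
| "letter_star (VarStar i) = Var i"

definition word_star :: "'n ncword \<Rightarrow> 'n ncword" where
  "word_star w = rev (map letter_star w)"

definition word_poly :: "'n ncword \<Rightarrow> ('n, 'k::real_or_complex) ncpoly" where
  "word_poly w = Poly_Mapping.single w 1"

definition const_poly :: "'k::real_or_complex \<Rightarrow> ('n, 'k) ncpoly" where
  "const_poly c = Poly_Mapping.single 0 c"

definition poly_star :: "('n, 'k::real_or_complex) ncpoly \<Rightarrow> ('n, 'k) ncpoly" where
  "poly_star p = (\<Sum>w\<in>Poly_Mapping.keys p. Poly_Mapping.single (word_star w) (conjugate (Poly_Mapping.lookup p w)))"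

definition hermitian :: "('n, 'k::real_or_complex) ncpoly \<Rightarrow> bool" where
  "hermitian p \<longleftrightarrow> poly_star p = p"

text \<open>The zero polynomial gets degree \<open>0\<close>.\<close>

definition ncdegree :: "('n, 'k::real_or_complex) ncpoly \<Rightarrow> nat" where
  "ncdegree p = Max (insert 0 (length ` Poly_Mapping.keys p))"

definition half_degree :: "('n, 'k::real_or_complex) ncpoly \<Rightarrow> nat" where
  "half_degree p = nat \<lceil>real (ncdegree p) / 2\<rceil>"

definition words :: "nat \<Rightarrow> 'n ncword set" where
  "words j = {w. length w \<le> j}"


section \<open>Quadratic modules\<close>

definition quadratic_module ::
    "nat \<Rightarrow> (nat \<Rightarrow> ('n, 'k::real_or_complex) ncpoly) \<Rightarrow> ('n, 'k) ncpoly set" where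
  "quadratic_module m q =
     {(\<Sum>f\<leftarrow>fs. poly_star f * f) + (\<Sum>i=1..m. \<Sum>g\<leftarrow>gs i. poly_star g * q i * g) | fs gs. True}"

definition archimedean ::
    "nat \<Rightarrow> (nat \<Rightarrow> ('n::finite, 'k::real_or_complex) ncpoly) \<Rightarrow> bool" where
  "archimedean m q \<longleftrightarrow>
     (\<exists>C::real. const_poly (of_real (C\<^sup>2)) - (\<Sum>l\<in>UNIV. word_poly [letter_star l] * word_poly [l])
        \<in> quadratic_module m q)"


section \<open>Hilbert spaces and operators\<close>

text \<open>
  A Hilbert space is a structure whose carrier is a subset of a type \<open>'u\<close>; the inner product is
  linear in its second argument. Operators are functions on \<open>'u\<close> of which only the values on the
  carrier matter.
\<close>

record ('k, 'u) hilbert = "('k, 'u) module" +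
  ip :: "'u \<Rightarrow> 'u \<Rightarrow> 'k"

definition hnorm :: "('k::real_or_complex, 'u) hilbert \<Rightarrow> 'u \<Rightarrow> real" where
  "hnorm H u = sqrt (real_part (ip H u u))"

text \<open>The locale \<open>Metric_space\<close> requires symmetry and nonnegativity outside the carrier, too.\<close>

definition hdist :: "('k::real_or_complex, 'u) hilbert \<Rightarrow> 'u \<Rightarrow> 'u \<Rightarrow> real" where
  "hdist H u v = (if u \<in> carrier H \<and> v \<in> carrier H then hnorm H (u \<ominus>\<^bsub>H\<^esub> v) else 0)"

locale hilbert_space = vectorspace class_ring H
  for H :: "('k::real_or_complex, 'u) hilbert" +
  assumes ip_add: "\<lbrakk>u \<in> carrier H; v \<in> carrier H; w \<in> carrier H\<rbrakk>
      \<Longrightarrow> ip H u (v \<oplus>\<^bsub>H\<^esub> w) = ip H u v + ip H u w"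
    and ip_smult: "\<lbrakk>u \<in> carrier H; v \<in> carrier H\<rbrakk> \<Longrightarrow> ip H u (c \<odot>\<^bsub>H\<^esub> v) = c * ip H u v"
    and ip_conjugate: "\<lbrakk>u \<in> carrier H; v \<in> carrier H\<rbrakk> \<Longrightarrow> ip H v u = conjugate (ip H u v)"
    and ip_nonneg: "u \<in> carrier H \<Longrightarrow> 0 \<le> ip H u u"
    and ip_definite: "\<lbrakk>u \<in> carrier H; ip H u u = 0\<rbrakk> \<Longrightarrow> u = \<zero>\<^bsub>H\<^esub>"
    and complete: "Metric_space.mcomplete (carrier H) (hdist H)"

definition bounded_operator :: "('k::real_or_complex, 'u) hilbert \<Rightarrow> ('u \<Rightarrow> 'u) \<Rightarrow> bool" where
  "bounded_operator H T \<longleftrightarrow>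
     T \<in> module_hom class_ring H H \<and> (\<exists>B. \<forall>u\<in>carrier H. hnorm H (T u) \<le> B * hnorm H u)"

definition adjoint_op :: "('k::real_or_complex, 'u) hilbert \<Rightarrow> ('u \<Rightarrow> 'u) \<Rightarrow> 'u \<Rightarrow> 'u" where
  "adjoint_op H T = (SOME S. bounded_operator H S \<and>
     (\<forall>u\<in>carrier H. \<forall>v\<in>carrier H. ip H u (T v) = ip H (S u) v))"

definition positive_op :: "('k::real_or_complex, 'u) hilbert \<Rightarrow> ('u \<Rightarrow> 'u) \<Rightarrow> bool" where
  "positive_op H T \<longleftrightarrow>
     (\<forall>u\<in>carrier H. \<forall>v\<in>carrier H. ip H u (T v) = ip H (T u) v) \<and>
     (\<forall>u\<in>carrier H. 0 \<le> ip H u (T u))"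

fun letter_op ::
    "('k::real_or_complex, 'u) hilbert \<Rightarrow> ('n \<Rightarrow> 'u \<Rightarrow> 'u) \<Rightarrow> 'n letter \<Rightarrow> 'u \<Rightarrow> 'u" where
  "letter_op H X (Var i) = X i"
| "letter_op H X (VarStar i) = adjoint_op H (X i)"

definition word_op ::
    "('k::real_or_complex, 'u) hilbert \<Rightarrow> ('n \<Rightarrow> 'u \<Rightarrow> 'u) \<Rightarrow> 'n ncword \<Rightarrow> 'u \<Rightarrow> 'u" where
  "word_op H X w = foldr (\<lambda>l T. letter_op H X l \<circ> T) w id"

definition poly_op ::
    "('k::real_or_complex, 'u) hilbert \<Rightarrow> ('n \<Rightarrow> 'u \<Rightarrow> 'u) \<Rightarrow> ('n, 'k) ncpoly \<Rightarrow> 'u \<Rightarrow> 'u" where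
  "poly_op H X p u = (\<Oplus>\<^bsub>H\<^esub>w\<in>Poly_Mapping.keys p. Poly_Mapping.lookup p w \<odot>\<^bsub>H\<^esub> word_op H X w u)"


section \<open>The optimization problem\<close>

definition problem_feasible ::
    "nat \<Rightarrow> (nat \<Rightarrow> ('n, 'k::real_or_complex) ncpoly) \<Rightarrow>
     ('k, 'u) hilbert \<Rightarrow> ('n \<Rightarrow> 'u \<Rightarrow> 'u) \<Rightarrow> 'u \<Rightarrow> bool" where
  "problem_feasible m q H X \<phi> \<longleftrightarrow>
     hilbert_space H \<and> (\<forall>i. bounded_operator H (X i)) \<and>
     \<phi> \<in> carrier H \<and> hnorm H \<phi> = 1 \<and> (\<forall>i\<in>{1..m}. positive_op H (poly_op H X (q i)))"

text \<open>For hermitian \<open>p\<close> the number \<open>ip H \<phi> (poly_op H X p \<phi>)\<close> is real.\<close>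

definition problem_objective ::
    "('n, 'k::real_or_complex) ncpoly \<Rightarrow> ('k, 'u) hilbert \<Rightarrow> ('n \<Rightarrow> 'u \<Rightarrow> 'u) \<Rightarrow> 'u \<Rightarrow> real" where
  "problem_objective p H X \<phi> = real_part (ip H \<phi> (poly_op H X p \<phi>))"

text \<open>
  The infimum is over all Hilbert spaces with carrier in the type given by the first argument. That
  type is a parameter because a formula cannot quantify over types; a carrier of any cardinality
  is obtained by a suitable choice of it.
\<close>

definition problem_value ::
    "'u itself \<Rightarrow> nat \<Rightarrow> (nat \<Rightarrow> ('n, 'k::real_or_complex) ncpoly) \<Rightarrow> ('n, 'k) ncpoly \<Rightarrow> ereal" where
  "problem_value _ m q p =
     (INF (H, X, \<phi>) \<in> {(H :: ('k, 'u) hilbert, X, \<phi>). problem_feasible m q H X \<phi>}.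
        ereal (problem_objective p H X \<phi>))"

definition global_optimizer ::
    "nat \<Rightarrow> (nat \<Rightarrow> ('n, 'k::real_or_complex) ncpoly) \<Rightarrow> ('n, 'k) ncpoly \<Rightarrow>
     ('k, 'u) hilbert \<Rightarrow> ('n \<Rightarrow> 'u \<Rightarrow> 'u) \<Rightarrow> 'u \<Rightarrow> bool" where
  "global_optimizer m q p H X \<phi> \<longleftrightarrow>
     problem_feasible m q H X \<phi> \<and>
     ereal (problem_objective p H X \<phi>) = problem_value TYPE('u) m q p"


section \<open>The relaxations\<close>

text \<open>Matrices with rows and columns indexed by a finite set \<open>I\<close> are functions of two arguments.\<close>

definition matrix_psd :: "'i set \<Rightarrow> ('i \<Rightarrow> 'i \<Rightarrow> 'k::real_or_complex) \<Rightarrow> bool" where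
  "matrix_psd I M \<longleftrightarrow>
     (\<forall>v\<in>I. \<forall>w\<in>I. M v w = conjugate (M w v)) \<and>
     (\<forall>c. 0 \<le> (\<Sum>v\<in>I. \<Sum>w\<in>I. conjugate (c v) * M v w * c w))"

text \<open>The library's rank is for matrices indexed by numbers; the enumeration does not affect it.\<close>

definition matrix_rank :: "'i set \<Rightarrow> ('i \<Rightarrow> 'i \<Rightarrow> 'k::field) \<Rightarrow> nat" where
  "matrix_rank I M =
     (let is = (SOME is. distinct is \<and> set is = I); n = card I
      in vec_space.rank n (mat n n (\<lambda>(a, b). M (is ! a) (is ! b))))"

definition riesz :: "('n ncword \<Rightarrow> 'k::real_or_complex) \<Rightarrow> ('n, 'k) ncpoly \<Rightarrow> 'k" where
  "riesz y f = (\<Sum>w\<in>Poly_Mapping.keys f. Poly_Mapping.lookup f w * y w)"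

definition moment_matrix ::
    "('n ncword \<Rightarrow> 'k::real_or_complex) \<Rightarrow> 'n ncword \<Rightarrow> 'n ncword \<Rightarrow> 'k" where
  "moment_matrix y v w = riesz y (poly_star (word_poly v) * word_poly w)"

definition localizing_matrix ::
    "('n, 'k::real_or_complex) ncpoly \<Rightarrow> ('n ncword \<Rightarrow> 'k) \<Rightarrow> 'n ncword \<Rightarrow> 'n ncword \<Rightarrow> 'k" where
  "localizing_matrix q y v w = riesz y (poly_star (word_poly v) * q * word_poly w)"

text \<open>
  A truncated sequence \<open>(y w)\<close> with \<open>length w \<le> 2 * k\<close> is given by a function on all words; the
  order-\<open>k\<close> relaxation of a problem whose polynomials have degree at most \<open>2 * k\<close> never looks at
  longer words.
\<close>

definition relaxation_feasible ::
    "nat \<Rightarrow> nat \<Rightarrow> (nat \<Rightarrow> ('n, 'k::real_or_complex) ncpoly) \<Rightarrow> ('n ncword \<Rightarrow> 'k) \<Rightarrow> bool" where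
  "relaxation_feasible k m q y \<longleftrightarrow>
     y [] = 1 \<and> matrix_psd (words k) (moment_matrix y) \<and>
     (\<forall>i\<in>{1..m}. matrix_psd (words (k - half_degree (q i))) (localizing_matrix (q i) y))"

text \<open>For hermitian \<open>p\<close> and feasible \<open>y\<close> the number \<open>riesz y p\<close> is real.\<close>

definition relaxation_value ::
    "nat \<Rightarrow> nat \<Rightarrow> (nat \<Rightarrow> ('n, 'k::real_or_complex) ncpoly) \<Rightarrow> ('n, 'k) ncpoly \<Rightarrow> ereal" where
  "relaxation_value k m q p = (INF y \<in> {y. relaxation_feasible k m q y}. ereal (real_part (riesz y p)))"

definition relaxation_optimal ::
    "nat \<Rightarrow> nat \<Rightarrow> (nat \<Rightarrow> ('n, 'k::real_or_complex) ncpoly) \<Rightarrow> ('n, 'k) ncpoly \<Rightarrow>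
     ('n ncword \<Rightarrow> 'k) \<Rightarrow> bool" where
  "relaxation_optimal k m q p y \<longleftrightarrow>
     relaxation_feasible k m q y \<and> ereal (real_part (riesz y p)) = relaxation_value k m q p"

end

theory Submission
  imports Defs
begin

unbundle no vec_syntax

text \<open>
  A feasible triple \<open>(H, X, \<phi>)\<close> yields the feasible moments \<open>y w = \<langle>\<phi>, w(X) \<phi>\<rangle>\<close>, so the relaxation
  is a lower bound. Conversely, if the ranks of the moment matrices of orders \<open>k\<close> and \<open>k - d\<close> agree,
  there are words \<open>b\<^sub>1, \<dots>, b\<^sub>r\<close> of length at most \<open>k - d\<close> whose columns form a basis of the column
  space of the moment matrix of order \<open>k\<close>. Their Gram matrix is positive definite and makes the
  coordinate space a Hilbert space of dimension \<open>r\<close>. As \<open>d \<ge> 1\<close>, left multiplication by a letter maps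
  every \<open>b\<^sub>j\<close> to a word of length at most \<open>k\<close>, whose column has coordinates in the basis; this defines
  the operators. They satisfy \<open>\<langle>a, w(X) b\<rangle> = y (a\<^sup>* w b)\<close> as long as the words involved have total
  length at most \<open>2 k\<close>, so the localizing matrices give positivity of \<open>q\<^sub>i(X)\<close> and the empty word
  gives the optimizer.
\<close>

section \<open>Scalars\<close>

text \<open>The usual GNS quotient by the null space of the moment form is avoided: the coordinates
  of a column in the basis play the role of the class of a word. The price is a basis that is not
  orthonormal, so the adjoint of a matrix operator is not its conjugate transpose. That left
  multiplication by a letter and by its star are adjoint comes from the identity
  \<open>M v (l # w) = M (letter_star l # v) w\<close> instead. The same identity, read on the rows
  \<open>letter_star l # b\<close> with \<open>b\<close> a basis word, carries a column relation for
  \<open>w\<close> to one for \<open>l # w\<close>; this spends the one spare letter. The full gap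
  \<open>d\<close> pays for the constraints: a word of \<open>q\<^sub>i\<close> has length at most
  \<open>2 * d\<close> and fits between two basis words. Two features of the setting add work. The
  adjoint is defined by choice, so the lower bound, which concerns arbitrary Hilbert spaces, rests
  on the Riesz representation theorem. The value of the problem is an infimum over carriers in one
  type \<open>'u\<close>, so the optimizer must be copied into \<open>'u\<close> by an injection
  \<open>J\<close>.\<close>

lemma real_part_of_real [simp]: "real_part (of_real r :: 'a::real_or_complex) = r"
proof -
  have "(of_real (real_part (of_real r :: 'a)) :: 'a) = of_real r"
    by (simp add: of_real_real_part conjugate_of_real)
  then show ?thesis by (simp only: of_real_eq_iff)
qed

lemma real_part_0 [simp]: "real_part (0 :: 'a::real_or_complex) = 0"
  using real_part_of_real[of 0] by simp

lemma conjugate_1 [simp]: "conjugate (1 :: 'a::real_or_complex) = 1"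
  using conjugate_of_real[of 1] by simp

lemma conjugate_diff: "conjugate (a - b) = conjugate a - conjugate (b :: 'a::real_or_complex)"
  using conjugate_dist_add[of a "- b"] by (simp add: conjugate_neg)

text \<open>Since \<open>of_real\<close> is injective, it suffices to compare the embedded values,
  where \<open>real_part z\<close> becomes half of \<open>z + conjugate z\<close>.\<close>

lemma real_part_add: "real_part (a + b) = real_part a + real_part (b :: 'a::real_or_complex)"
proof -
  have "(of_real (real_part (a + b)) :: 'a) = of_real (real_part a + real_part b)"
    by (simp add: of_real_real_part conjugate_dist_add field_simps)
  then show ?thesis by (simp only: of_real_eq_iff)
qed

lemma real_part_minus: "real_part (- a) = - real_part (a :: 'a::real_or_complex)"
  using real_part_add[of a "- a"] by simp

lemma real_part_diff: "real_part (a - b) = real_part a - real_part (b :: 'a::real_or_complex)"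
  using real_part_add[of a "- b"] by (simp add: real_part_minus)

lemma real_part_conjugate [simp]: "real_part (conjugate a) = real_part (a :: 'a::real_or_complex)"
proof -
  have "(of_real (real_part (conjugate a)) :: 'a) = of_real (real_part a)"
    by (simp add: of_real_real_part add.commute)
  then show ?thesis by (simp only: of_real_eq_iff)
qed

lemma real_part_of_real_mult:
  "real_part (of_real r * a) = r * real_part (a :: 'a::real_or_complex)"
proof -
  have "(of_real (real_part (of_real r * a)) :: 'a) = of_real (r * real_part a)"
    by (simp add: of_real_real_part conjugate_dist_mul conjugate_of_real field_simps)
  then show ?thesis by (simp only: of_real_eq_iff)
qed

lemma norm_conjugate [simp]: "norm (conjugate a) = norm (a :: 'a::real_or_complex)"
proof -
  have "(of_real ((norm (conjugate a))\<^sup>2) :: 'a) = of_real ((norm a)\<^sup>2)"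
    by (simp only: mult_conjugate_norm[symmetric]) (simp add: mult.commute)
  then show ?thesis by (simp only: of_real_eq_iff) simp
qed

lemma abs_real_part_le: "\<bar>real_part a\<bar> \<le> norm (a :: 'a::real_or_complex)"
proof -
  have "\<bar>real_part a\<bar> = norm (of_real (real_part a) :: 'a)" by simp
  also have "\<dots> = norm (a + conjugate a) / 2"
    by (simp add: of_real_real_part norm_divide)
  also have "\<dots> \<le> norm a" using norm_triangle_ineq[of a "conjugate a"] by simp
  finally show ?thesis .
qed

lemma zero_le_scalar_iff:
  "0 \<le> (a :: 'a::real_or_complex) \<longleftrightarrow> a = of_real (real_part a) \<and> 0 \<le> real_part a"
  by (metis of_real_def real_part_of_real zero_le_iff_scaleR)

lemma real_part_nonneg: "0 \<le> (a :: 'a::real_or_complex) \<Longrightarrow> 0 \<le> real_part a"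
  by (rule zero_le_scalar_iff[THEN iffD1, THEN conjunct2])

lemma real_part_conjugate_mult_self:
  "real_part (conjugate a * a) = (norm (a :: 'a::real_or_complex))\<^sup>2"
  by (metis mult.commute mult_conjugate_norm real_part_of_real)

text \<open>The class \<open>real_or_complex\<close> does not assume completeness of the norm.\<close>

lemma convergent_scalar:
  fixes f :: "nat \<Rightarrow> 'a::real_or_complex"
  assumes "Cauchy f"
  shows "\<exists>l. f \<longlonglongrightarrow> l"
proof -
  \<comment> \<open>Real parts of multiples see every coordinate of \<open>f n\<close>:
    \<open>c = 1\<close> gives one, and an imaginary unit as \<open>c\<close> gives the
    other.\<close>
  have conv: "convergent (\<lambda>n. real_part (c * f n))" for c
  proof -
    have "Cauchy (\<lambda>n. real_part (c * f n))"
    proof (rule CauchyI)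
      fix e :: real assume e: "e > 0"
      \<comment> \<open>The \<open>+ 1\<close> keeps the quotient meaningful for
        \<open>c = 0\<close>.\<close>
      then have "e / (norm c + 1) > 0" by (simp add: add_nonneg_pos)
      then obtain M where M: "\<And>m n. m \<ge> M \<Longrightarrow> n \<ge> M \<Longrightarrow> norm (f m - f n) < e / (norm c + 1)"
        using CauchyD[OF assms] by meson
      have "norm (real_part (c * f m) - real_part (c * f n)) < e" if "m \<ge> M" "n \<ge> M" for m n
      proof -
        have "norm (real_part (c * f m) - real_part (c * f n)) \<le> norm (c * f m - c * f n)"
          using abs_real_part_le[of "c * f m - c * f n"] by (simp add: real_part_diff)
        also have "\<dots> = norm c * norm (f m - f n)"
          by (simp add: norm_mult flip: right_diff_distrib)
        also have "\<dots> \<le> (norm c + 1) * norm (f m - f n)"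
          by (simp add: mult_right_mono)
        also have "\<dots> < e"
          using M[OF that] by (simp add: pos_less_divide_eq add_nonneg_pos mult.commute)
        finally show ?thesis .
      qed
      then show "\<exists>M. \<forall>m\<ge>M. \<forall>n\<ge>M. norm (real_part (c * f m) - real_part (c * f n)) < e" by blast
    qed
    then show ?thesis by (rule real_Cauchy_convergent)
  qed
  show ?thesis
    using real_or_complex_cases[where 'a = 'a]
  proof
    assume *: "\<forall>z::'a. conjugate z = z \<and> z = of_real (real_part z)"
    obtain l where "(\<lambda>n. real_part (1 * f n)) \<longlonglongrightarrow> l"
      using conv[of 1] unfolding convergent_def by blast
    then have "(\<lambda>n. of_real (real_part (f n)) :: 'a) \<longlonglongrightarrow> of_real l"
      by (intro tendsto_of_real) simp
    then show ?thesis using * by (auto simp flip: *[rule_format, THEN conjunct2])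
  next
    assume "\<exists>i::'a. i * i = -1 \<and> conjugate i = - i \<and> (\<forall>z. \<exists>a b. z = of_real a + of_real b * i)"
    then obtain i :: 'a where ii: "i * i = -1" and ci: "conjugate i = - i"
      and ex: "\<And>z. \<exists>a b. z = of_real a + of_real b * i" by blast
    \<comment> \<open>For \<open>z = a + b * i\<close> the product \<open>i * z\<close> has real
      part \<open>- b\<close>.\<close>
    have eq: "z = of_real (real_part z) - of_real (real_part (i * z)) * i" for z :: 'a
    proof -
      have "of_real (real_part (i * z)) * i = (i * i * z - i * i * conjugate z) / 2"
        by (simp add: of_real_real_part conjugate_dist_mul ci algebra_simps)
      then show ?thesis by (simp add: ii of_real_real_part field_simps)
    qed
    obtain l where l: "(\<lambda>n. real_part (1 * f n)) \<longlonglongrightarrow> l"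
      using conv[of 1] unfolding convergent_def by blast
    obtain l' where l': "(\<lambda>n. real_part (i * f n)) \<longlonglongrightarrow> l'"
      using conv[of i] unfolding convergent_def by blast
    have "(\<lambda>n. of_real (real_part (f n)) - of_real (real_part (i * f n)) * i) \<longlonglongrightarrow> of_real l - of_real l' * i"
      using l l' by (intro tendsto_intros) auto
    then show ?thesis by (auto simp flip: eq)
  qed
qed

section \<open>Hilbert spaces\<close>

text \<open>
  Completeness of a Gram space is proved from the Cauchy--Schwarz inequality, so the latter has to
  be available without it.
\<close>

locale inner_product_space = vectorspace class_ring H
  for H :: "('k::real_or_complex, 'u) hilbert" +
  assumes ip_add: "\<lbrakk>u \<in> carrier H; v \<in> carrier H; w \<in> carrier H\<rbrakk>
      \<Longrightarrow> ip H u (v \<oplus>\<^bsub>H\<^esub> w) = ip H u v + ip H u w"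
    and ip_smult: "\<lbrakk>u \<in> carrier H; v \<in> carrier H\<rbrakk> \<Longrightarrow> ip H u (c \<odot>\<^bsub>H\<^esub> v) = c * ip H u v"
    and ip_conjugate: "\<lbrakk>u \<in> carrier H; v \<in> carrier H\<rbrakk> \<Longrightarrow> ip H v u = conjugate (ip H u v)"
    and ip_nonneg: "u \<in> carrier H \<Longrightarrow> 0 \<le> ip H u u"
    and ip_definite: "\<lbrakk>u \<in> carrier H; ip H u u = 0\<rbrakk> \<Longrightarrow> u = \<zero>\<^bsub>H\<^esub>"
begin

lemma minus_conv_smult: "u \<in> carrier H \<Longrightarrow> \<ominus>\<^bsub>H\<^esub> u = (- 1) \<odot>\<^bsub>H\<^esub> u"
  using smult_minus_1[of u] by (simp add: class_ring_simps)

lemma smult_closed' [simp]: "u \<in> carrier H \<Longrightarrow> c \<odot>\<^bsub>H\<^esub> u \<in> carrier H"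
  by (simp add: smult_closed)

lemma ip_add_left: "\<lbrakk>u \<in> carrier H; v \<in> carrier H; w \<in> carrier H\<rbrakk>
    \<Longrightarrow> ip H (u \<oplus>\<^bsub>H\<^esub> v) w = ip H u w + ip H v w"
  by (metis add.m_closed conjugate_dist_add ip_add ip_conjugate)

lemma ip_smult_left: "\<lbrakk>u \<in> carrier H; v \<in> carrier H\<rbrakk> \<Longrightarrow> ip H (c \<odot>\<^bsub>H\<^esub> u) v = conjugate c * ip H u v"
  using ip_conjugate[of v "c \<odot>\<^bsub>H\<^esub> u"] ip_conjugate[of v u] by (simp add: ip_smult conjugate_dist_mul)

lemma ip_minus_right: "\<lbrakk>u \<in> carrier H; v \<in> carrier H\<rbrakk> \<Longrightarrow> ip H u (\<ominus>\<^bsub>H\<^esub> v) = - ip H u v"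
  by (simp add: minus_conv_smult ip_smult)

lemma ip_diff_right: "\<lbrakk>u \<in> carrier H; v \<in> carrier H; w \<in> carrier H\<rbrakk>
    \<Longrightarrow> ip H u (v \<ominus>\<^bsub>H\<^esub> w) = ip H u v - ip H u w"
  by (simp add: a_minus_def ip_add ip_minus_right)

lemma ip_zero_right [simp]: "u \<in> carrier H \<Longrightarrow> ip H u \<zero>\<^bsub>H\<^esub> = 0"
  using ip_add[of u "\<zero>\<^bsub>H\<^esub>" "\<zero>\<^bsub>H\<^esub>"] by simp

lemma ip_zero_left [simp]: "u \<in> carrier H \<Longrightarrow> ip H \<zero>\<^bsub>H\<^esub> u = 0"
  using ip_conjugate[of u "\<zero>\<^bsub>H\<^esub>"] by simp

lemma ip_finsum_right:
  assumes "finite A" "u \<in> carrier H" "f \<in> A \<rightarrow> carrier H"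
  shows "ip H u (finsum H f A) = (\<Sum>a\<in>A. ip H u (f a))"
  using assms by (induction rule: finite_induct) (auto simp: ip_add Pi_iff)

lemma ip_finsum_left:
  assumes "finite A" "u \<in> carrier H" "f \<in> A \<rightarrow> carrier H"
  shows "ip H (finsum H f A) u = (\<Sum>a\<in>A. ip H (f a) u)"
  using assms by (induction rule: finite_induct) (auto simp: ip_add_left Pi_iff)

lemma hnorm_square_real_part: "u \<in> carrier H \<Longrightarrow> (hnorm H u)\<^sup>2 = real_part (ip H u u)"
  using real_part_nonneg[OF ip_nonneg] by (simp add: hnorm_def)

lemma ip_self: "u \<in> carrier H \<Longrightarrow> ip H u u = of_real ((hnorm H u)\<^sup>2)"
  by (metis hnorm_square_real_part ip_nonneg zero_le_scalar_iff)

lemma hnorm_nonneg [simp]: "u \<in> carrier H \<Longrightarrow> 0 \<le> hnorm H u"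
  using real_part_nonneg[OF ip_nonneg] by (simp add: hnorm_def)

lemma hnorm_zero [simp]: "hnorm H \<zero>\<^bsub>H\<^esub> = 0"
  by (simp add: hnorm_def)

lemma hnorm_eq_0_iff: "u \<in> carrier H \<Longrightarrow> hnorm H u = 0 \<longleftrightarrow> u = \<zero>\<^bsub>H\<^esub>"
  using ip_definite[of u] ip_self[of u] by auto

lemma hnorm_smult: "u \<in> carrier H \<Longrightarrow> hnorm H (c \<odot>\<^bsub>H\<^esub> u) = norm c * hnorm H u"
proof -
  assume u: "u \<in> carrier H"
  have "ip H (c \<odot>\<^bsub>H\<^esub> u) (c \<odot>\<^bsub>H\<^esub> u) = (c * conjugate c) * ip H u u"
    using u by (simp add: ip_smult ip_smult_left)
  also have "\<dots> = of_real ((norm c * hnorm H u)\<^sup>2)"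
    by (simp add: mult_conjugate_norm ip_self u power_mult_distrib)
  finally have "(hnorm H (c \<odot>\<^bsub>H\<^esub> u))\<^sup>2 = (norm c * hnorm H u)\<^sup>2"
    using u by (simp only: hnorm_square_real_part smult_closed' real_part_of_real)
  then show ?thesis using u by simp
qed

lemma hnorm_add_square: "\<lbrakk>u \<in> carrier H; v \<in> carrier H\<rbrakk>
    \<Longrightarrow> (hnorm H (u \<oplus>\<^bsub>H\<^esub> v))\<^sup>2 = (hnorm H u)\<^sup>2 + 2 * real_part (ip H u v) + (hnorm H v)\<^sup>2"
  by (simp add: hnorm_square_real_part ip_add ip_add_left real_part_add ip_conjugate[of u v])

lemma hnorm_uminus: "u \<in> carrier H \<Longrightarrow> hnorm H (\<ominus>\<^bsub>H\<^esub> u) = hnorm H u"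
  by (simp add: minus_conv_smult hnorm_smult)

lemma hnorm_diff_square: "\<lbrakk>u \<in> carrier H; v \<in> carrier H\<rbrakk>
    \<Longrightarrow> (hnorm H (u \<ominus>\<^bsub>H\<^esub> v))\<^sup>2 = (hnorm H u)\<^sup>2 - 2 * real_part (ip H u v) + (hnorm H v)\<^sup>2"
  by (simp add: a_minus_def hnorm_add_square ip_minus_right real_part_minus hnorm_uminus)

lemma cauchy_schwarz:
  assumes u: "u \<in> carrier H" and v: "v \<in> carrier H"
  shows "norm (ip H u v) \<le> hnorm H u * hnorm H v"
proof (cases "u = \<zero>\<^bsub>H\<^esub>")
  case True
  then show ?thesis using v by simp
next
  case False
  then have pos: "hnorm H u > 0"
    using u hnorm_eq_0_iff hnorm_nonneg by (metis less_eq_real_def)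
  \<comment> \<open>\<open>t * z\<close> is the coefficient of the orthogonal projection of
    \<open>v\<close> onto \<open>u\<close>; the claim is the nonnegativity of the squared norm of
    the remainder.\<close>
  define t where "t = 1 / (hnorm H u)\<^sup>2"
  define z where "z = ip H u v"
  have "real_part (ip H v ((of_real t * z) \<odot>\<^bsub>H\<^esub> u)) = t * (norm z)\<^sup>2"
  proof -
    have "ip H v ((of_real t * z) \<odot>\<^bsub>H\<^esub> u) = of_real t * (z * conjugate z)"
      using u v by (simp add: ip_smult z_def ip_conjugate[of u v])
    then show ?thesis by (simp only: mult_conjugate_norm real_part_of_real_mult real_part_of_real)
  qed
  then have "(hnorm H (v \<ominus>\<^bsub>H\<^esub> (of_real t * z) \<odot>\<^bsub>H\<^esub> u))\<^sup>2
      = (hnorm H v)\<^sup>2 - 2 * (t * (norm z)\<^sup>2) + (\<bar>t\<bar> * norm z * hnorm H u)\<^sup>2"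
    using u v by (simp add: hnorm_diff_square hnorm_smult norm_mult)
  also have "(\<bar>t\<bar> * norm z * hnorm H u)\<^sup>2 = t * (norm z)\<^sup>2"
    using pos by (simp add: t_def power2_eq_square field_simps)
  finally have "0 \<le> (hnorm H v)\<^sup>2 - t * (norm z)\<^sup>2"
    using zero_le_power2[of "hnorm H (v \<ominus>\<^bsub>H\<^esub> (of_real t * z) \<odot>\<^bsub>H\<^esub> u)"] by linarith
  then have "(norm z)\<^sup>2 \<le> (hnorm H u * hnorm H v)\<^sup>2"
    using pos by (simp add: t_def field_simps power_mult_distrib)
  then show ?thesis
    unfolding z_def by (rule power2_le_imp_le) (use u v in simp)
qed

lemma hnorm_triangle:
  assumes u: "u \<in> carrier H" and v: "v \<in> carrier H"
  shows "hnorm H (u \<oplus>\<^bsub>H\<^esub> v) \<le> hnorm H u + hnorm H v"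
proof (rule power2_le_imp_le)
  have "real_part (ip H u v) \<le> hnorm H u * hnorm H v"
    using cauchy_schwarz[OF u v] abs_real_part_le[of "ip H u v"] by linarith
  then show "(hnorm H (u \<oplus>\<^bsub>H\<^esub> v))\<^sup>2 \<le> (hnorm H u + hnorm H v)\<^sup>2"
    using u v by (simp add: hnorm_add_square power2_sum)
qed (use u v in simp)

lemma hnorm_diff_commute: "\<lbrakk>u \<in> carrier H; v \<in> carrier H\<rbrakk> \<Longrightarrow> hnorm H (u \<ominus>\<^bsub>H\<^esub> v) = hnorm H (v \<ominus>\<^bsub>H\<^esub> u)"
proof -
  assume u: "u \<in> carrier H" and v: "v \<in> carrier H"
  have "\<ominus>\<^bsub>H\<^esub> (u \<ominus>\<^bsub>H\<^esub> v) = v \<ominus>\<^bsub>H\<^esub> u"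
    using u v by (simp add: a_minus_def minus_add add.m_comm)
  then show ?thesis
    using u v hnorm_uminus[of "u \<ominus>\<^bsub>H\<^esub> v"] by (metis minus_closed)
qed

lemma Metric_space: "Metric_space (carrier H) (hdist H)"
proof
  show "0 \<le> hdist H x y" for x y
    by (simp add: hdist_def)
  show "hdist H x y = hdist H y x" for x y
    by (simp add: hdist_def hnorm_diff_commute)
  show "hdist H x y = 0 \<longleftrightarrow> x = y" if "x \<in> carrier H" "y \<in> carrier H" for x y
    using that by (simp add: hdist_def hnorm_eq_0_iff)
  show "hdist H x z \<le> hdist H x y + hdist H y z"
    if "x \<in> carrier H" "y \<in> carrier H" "z \<in> carrier H" for x y z
  proof -
    have "x \<ominus>\<^bsub>H\<^esub> z = (x \<ominus>\<^bsub>H\<^esub> y) \<oplus>\<^bsub>H\<^esub> (y \<ominus>\<^bsub>H\<^esub> z)"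
      using that by (simp add: a_minus_def a_assoc r_neg1 r_neg2)
    then show ?thesis
      using that by (simp add: hdist_def hnorm_triangle)
  qed
qed

lemma hilbert_eqI:
  assumes "u \<in> carrier H" "v \<in> carrier H" "\<And>w. w \<in> carrier H \<Longrightarrow> ip H w u = ip H w v"
  shows "u = v"
proof -
  have "ip H (u \<ominus>\<^bsub>H\<^esub> v) (u \<ominus>\<^bsub>H\<^esub> v) = 0"
    using assms by (simp add: ip_diff_right)
  then have "u \<ominus>\<^bsub>H\<^esub> v = \<zero>\<^bsub>H\<^esub>"
    using assms by (intro ip_definite) auto
  then show ?thesis
    using assms by simp
qed

end

sublocale hilbert_space \<subseteq> inner_product_space H
  by unfold_locales (fact ip_add ip_smult ip_conjugate ip_nonneg ip_definite)+

section \<open>Completeness, the Riesz representation theorem and adjoints\<close>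

context hilbert_space
begin

lemma complete_sequence:
  assumes \<sigma>: "\<And>n. \<sigma> n \<in> carrier H"
    and cau: "\<And>e. e > 0 \<Longrightarrow> \<exists>N. \<forall>m\<ge>N. \<forall>n\<ge>N. hnorm H (\<sigma> m \<ominus>\<^bsub>H\<^esub> \<sigma> n) < e"
  obtains z where "z \<in> carrier H" "(\<lambda>n. hnorm H (\<sigma> n \<ominus>\<^bsub>H\<^esub> z)) \<longlonglongrightarrow> 0"
proof -
  interpret M: Metric_space "carrier H" "hdist H" by (rule Metric_space)
  have "M.MCauchy \<sigma>"
    unfolding M.MCauchy_def using \<sigma> cau by (auto simp: hdist_def image_subset_iff)
  then obtain z where z: "limitin M.mtopology \<sigma> z sequentially"
    using complete unfolding M.mcomplete_def by blast
  then have "z \<in> carrier H" by (simp add: M.limitin_metric)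
  moreover have "(\<lambda>n. hnorm H (\<sigma> n \<ominus>\<^bsub>H\<^esub> z)) \<longlonglongrightarrow> 0"
    using z \<sigma> \<open>z \<in> carrier H\<close> unfolding M.limitin_metric_dist_null
    by (simp add: hdist_def)
  ultimately show ?thesis by (rule that)
qed

lemma hnorm_reverse_triangle:
  assumes u: "u \<in> carrier H" and v: "v \<in> carrier H"
  shows "\<bar>hnorm H u - hnorm H v\<bar> \<le> hnorm H (u \<ominus>\<^bsub>H\<^esub> v)"
proof -
  have *: "hnorm H a - hnorm H b \<le> hnorm H (a \<ominus>\<^bsub>H\<^esub> b)" if "a \<in> carrier H" "b \<in> carrier H" for a b
  proof -
    have "a = (a \<ominus>\<^bsub>H\<^esub> b) \<oplus>\<^bsub>H\<^esub> b"
      using that by (simp add: a_minus_def a_assoc l_neg)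
    then have "hnorm H a \<le> hnorm H (a \<ominus>\<^bsub>H\<^esub> b) + hnorm H b"
      using that hnorm_triangle[of "a \<ominus>\<^bsub>H\<^esub> b" b] by simp
    then show ?thesis by simp
  qed
  show ?thesis
    using *[OF u v] *[OF v u] hnorm_diff_commute[OF u v] by simp
qed

text \<open>
  The representing vector minimizes \<open>\<parallel>u\<parallel>\<^sup>2 - 2 Re (f u)\<close>: a minimizing sequence is Cauchy by the
  parallelogram identity, and the first variation vanishes at its limit.
\<close>

lemma riesz_representation:
  fixes f :: "'u \<Rightarrow> 'k"
  assumes add: "\<And>u v. u \<in> carrier H \<Longrightarrow> v \<in> carrier H \<Longrightarrow> f (u \<oplus>\<^bsub>H\<^esub> v) = f u + f v"
    and smult: "\<And>c u. u \<in> carrier H \<Longrightarrow> f (c \<odot>\<^bsub>H\<^esub> u) = c * f u"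
    and bound: "\<And>u. u \<in> carrier H \<Longrightarrow> norm (f u) \<le> B * hnorm H u"
  obtains z where "z \<in> carrier H" "\<And>u. u \<in> carrier H \<Longrightarrow> f u = ip H z u"
proof -
  have diff: "f (u \<ominus>\<^bsub>H\<^esub> v) = f u - f v" if "u \<in> carrier H" "v \<in> carrier H" for u v
    using that add[of u "(-1) \<odot>\<^bsub>H\<^esub> v"] smult[of v "-1"] by (simp add: a_minus_def minus_conv_smult)
  define J where "J u = (hnorm H u)\<^sup>2 - 2 * real_part (f u)" for u
  \<comment> \<open>Completing the square: \<open>J u\<close> is at least
    \<open>(hnorm H u - B)\<^sup>2 - B\<^sup>2\<close>.\<close>
  have J_lower: "- B\<^sup>2 \<le> J u" if u: "u \<in> carrier H" for u
  proof -
    have "real_part (f u) \<le> B * hnorm H u"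
      using abs_real_part_le[of "f u"] bound[OF u] by linarith
    moreover have "0 \<le> (hnorm H u - B)\<^sup>2" by simp
    ultimately show ?thesis
      unfolding J_def by (simp add: power2_eq_square algebra_simps)
  qed
  define m where "m = Inf (J ` carrier H)"
  have bdd: "bdd_below (J ` carrier H)"
    using J_lower by (intro bdd_belowI2[of _ "- B\<^sup>2"])
  have m_le: "m \<le> J u" if "u \<in> carrier H" for u
    unfolding m_def using bdd that by (rule cINF_lower)
  have "\<exists>u\<in>carrier H. J u < m + 1 / real (Suc n)" for n
  proof -
    have "\<exists>x\<in>J ` carrier H. x < m + 1 / real (Suc n)"
      unfolding m_def by (rule cInf_lessD) auto
    then show ?thesis by blast
  qed
  then obtain \<sigma> where \<sigma>: "\<And>n. \<sigma> n \<in> carrier H" and J\<sigma>: "\<And>n. J (\<sigma> n) < m + 1 / real (Suc n)"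
    by metis
  \<comment> \<open>The infimum \<open>m\<close> is compared with \<open>J\<close> at the midpoint
    of \<open>u\<close> and \<open>v\<close>.\<close>
  have par: "(hnorm H (u \<ominus>\<^bsub>H\<^esub> v))\<^sup>2 \<le> 2 * (J u - m) + 2 * (J v - m)"
    if u: "u \<in> carrier H" and v: "v \<in> carrier H" for u v
  proof -
    have "(hnorm H ((1/2) \<odot>\<^bsub>H\<^esub> (u \<oplus>\<^bsub>H\<^esub> v)))\<^sup>2 = (hnorm H (u \<oplus>\<^bsub>H\<^esub> v))\<^sup>2 / 4"
      using u v by (simp add: hnorm_smult norm_divide power_divide)
    moreover have "real_part (f ((1/2) \<odot>\<^bsub>H\<^esub> (u \<oplus>\<^bsub>H\<^esub> v))) = real_part (f u + f v) / 2"
    proof -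
      have "f ((1/2) \<odot>\<^bsub>H\<^esub> (u \<oplus>\<^bsub>H\<^esub> v)) = of_real (1/2) * (f u + f v)"
        using u v by (simp add: smult add)
      then show ?thesis by (simp only: real_part_of_real_mult)
    qed
    ultimately have "(hnorm H (u \<oplus>\<^bsub>H\<^esub> v))\<^sup>2 / 4 - real_part (f u) - real_part (f v) \<ge> m"
      using m_le[of "(1/2) \<odot>\<^bsub>H\<^esub> (u \<oplus>\<^bsub>H\<^esub> v)"] u v by (simp add: J_def real_part_add)
    then show ?thesis
      unfolding J_def hnorm_add_square[OF u v] hnorm_diff_square[OF u v] by (simp add: field_simps)
  qed
  have cau: "\<exists>N. \<forall>k\<ge>N. \<forall>n\<ge>N. hnorm H (\<sigma> k \<ominus>\<^bsub>H\<^esub> \<sigma> n) < e" if e: "e > 0" for e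
  proof -
    obtain N where N: "1 / real (Suc N) < e\<^sup>2 / 4"
      using reals_Archimedean[of "e\<^sup>2 / 4"] e by (auto simp: inverse_eq_divide)
    have "hnorm H (\<sigma> k \<ominus>\<^bsub>H\<^esub> \<sigma> n) < e" if "k \<ge> N" "n \<ge> N" for k n
    proof (rule power_less_imp_less_base)
      have "J (\<sigma> i) - m < e\<^sup>2 / 4" if "i \<ge> N" for i
      proof -
        have "1 / real (Suc i) \<le> 1 / real (Suc N)" using that by (simp add: frac_le)
        then show ?thesis using J\<sigma>[of i] N by linarith
      qed
      from this[OF that(1)] this[OF that(2)] par[OF \<sigma> \<sigma>, of k n]
      show "(hnorm H (\<sigma> k \<ominus>\<^bsub>H\<^esub> \<sigma> n))\<^sup>2 < e\<^sup>2" by (simp add: field_simps)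
    qed (use e in simp)
    then show ?thesis by blast
  qed
  obtain z where z: "z \<in> carrier H" and lim: "(\<lambda>n. hnorm H (\<sigma> n \<ominus>\<^bsub>H\<^esub> z)) \<longlonglongrightarrow> 0"
    using complete_sequence[OF \<sigma> cau] by blast
  have "(\<lambda>n. hnorm H (\<sigma> n)) \<longlonglongrightarrow> hnorm H z"
    by (rule LIM_zero_cancel, rule Lim_null_comparison[OF _ lim])
      (use z \<sigma> hnorm_reverse_triangle in simp)
  moreover have "(\<lambda>n. real_part (f (\<sigma> n))) \<longlonglongrightarrow> real_part (f z)"
  proof (rule LIM_zero_cancel, rule Lim_null_comparison)
    show "(\<lambda>n. B * hnorm H (\<sigma> n \<ominus>\<^bsub>H\<^esub> z)) \<longlonglongrightarrow> 0"
      using tendsto_mult_left[OF lim, of B] by simp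
    have "norm (real_part (f (\<sigma> n)) - real_part (f z)) \<le> B * hnorm H (\<sigma> n \<ominus>\<^bsub>H\<^esub> z)" for n
      using abs_real_part_le[of "f (\<sigma> n \<ominus>\<^bsub>H\<^esub> z)"] bound[of "\<sigma> n \<ominus>\<^bsub>H\<^esub> z"] \<sigma>[of n] z
      by (simp add: diff real_part_diff)
    then show "\<forall>\<^sub>F n in sequentially. norm (real_part (f (\<sigma> n)) - real_part (f z)) \<le> B * hnorm H (\<sigma> n \<ominus>\<^bsub>H\<^esub> z)"
      by simp
  qed
  ultimately have "(\<lambda>n. J (\<sigma> n)) \<longlonglongrightarrow> J z"
    unfolding J_def by (intro tendsto_intros)
  moreover have "(\<lambda>n. m + 1 / real (Suc n)) \<longlonglongrightarrow> m + 0"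
    by (intro tendsto_intros) (rule LIMSEQ_Suc[OF lim_1_over_n])
  ultimately have "J z \<le> m + 0"
    by (rule LIMSEQ_le) (use J\<sigma> less_imp_le in blast)
  then have Jz: "J z = m" using m_le[OF z] by simp
  have re: "real_part (ip H z u - f u) = 0" if u: "u \<in> carrier H" for u
  proof (rule ccontr)
    define r where "r = real_part (ip H z u - f u)"
    define s where "s = (hnorm H u)\<^sup>2"
    assume "real_part (ip H z u - f u) \<noteq> 0"
    then have r: "r \<noteq> 0" by (simp add: r_def)
    have var: "0 \<le> 2 * t * r + t\<^sup>2 * s" for t
    proof -
      let ?v = "of_real t \<odot>\<^bsub>H\<^esub> u"
      have "J (z \<oplus>\<^bsub>H\<^esub> ?v) = J z + 2 * t * r + t\<^sup>2 * s"
        using u z by (simp add: J_def hnorm_add_square hnorm_smult add smult ip_smult real_part_add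
            real_part_of_real_mult r_def s_def real_part_diff power_mult_distrib algebra_simps)
      then show ?thesis using m_le[of "z \<oplus>\<^bsub>H\<^esub> ?v"] u z Jz by simp
    qed
    have s: "s \<ge> 0" by (simp add: s_def)
    \<comment> \<open>At \<open>t = - q\<close> the linear term dominates and the variation equals
      \<open>- (q\<^sup>2 * (s + 2))\<close>; the \<open>+ 1\<close> covers
      \<open>s = 0\<close>.\<close>
    define q where "q = r / (s + 1)"
    have rq: "r = q * (s + 1)" and q: "q \<noteq> 0"
      using s r by (auto simp: q_def)
    have "0 \<le> 2 * (- q) * r + (- q)\<^sup>2 * s" by (rule var)
    also have "\<dots> = - (q\<^sup>2 * (s + 2))"
      by (simp add: rq algebra_simps power2_eq_square)
    also have "\<dots> < 0" using q s by simp
    finally show False by simp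
  qed
  have "f u = ip H z u" if u: "u \<in> carrier H" for u
  proof -
    \<comment> \<open>So far only real parts agree. Multiplying \<open>u\<close> by the conjugate of
      the discrepancy \<open>?c\<close> turns the real part of the discrepancy into its squared
      norm.\<close>
    let ?c = "ip H z u - f u"
    have "ip H z (conjugate ?c \<odot>\<^bsub>H\<^esub> u) - f (conjugate ?c \<odot>\<^bsub>H\<^esub> u) = conjugate ?c * ?c"
      using u z by (simp add: ip_smult smult algebra_simps)
    then have "(norm ?c)\<^sup>2 = 0"
      using re[of "conjugate ?c \<odot>\<^bsub>H\<^esub> u"] u by (simp add: real_part_conjugate_mult_self)
    then show ?thesis by simp
  qed
  with z show ?thesis by (rule that)
qed

lemma bounded_operatorD:
  assumes "bounded_operator H T"
  shows bounded_operator_closed: "u \<in> carrier H \<Longrightarrow> T u \<in> carrier H"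
    and bounded_operator_add: "u \<in> carrier H \<Longrightarrow> v \<in> carrier H \<Longrightarrow> T (u \<oplus>\<^bsub>H\<^esub> v) = T u \<oplus>\<^bsub>H\<^esub> T v"
    and bounded_operator_smult: "u \<in> carrier H \<Longrightarrow> T (c \<odot>\<^bsub>H\<^esub> u) = c \<odot>\<^bsub>H\<^esub> T u"
  using assms unfolding bounded_operator_def module_hom_def by auto

lemma bounded_operator_pos_bound:
  assumes "bounded_operator H T"
  obtains B where "B \<ge> 0" "\<And>u. u \<in> carrier H \<Longrightarrow> hnorm H (T u) \<le> B * hnorm H u"
proof -
  obtain B where B: "\<And>u. u \<in> carrier H \<Longrightarrow> hnorm H (T u) \<le> B * hnorm H u"
    using assms unfolding bounded_operator_def by blast
  show thesis
  proof (rule that[of "\<bar>B\<bar>"])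
    show "hnorm H (T u) \<le> \<bar>B\<bar> * hnorm H u" if "u \<in> carrier H" for u
      using B[OF that] mult_right_mono[OF abs_ge_self, of "hnorm H u" B] that by simp
  qed simp
qed

text \<open>Riesz representation of \<open>\<lambda>v. ip H u (T v)\<close> supplies the value at
  \<open>u\<close>. Linearity holds because a vector is determined by its inner products, and the
  bound of \<open>T\<close> carries over because the squared norm of \<open>S u\<close> is the inner
  product of \<open>u\<close> with \<open>T (S u)\<close>.\<close>

lemma adjoint_exists:
  assumes T: "bounded_operator H T"
  shows "\<exists>S. bounded_operator H S \<and> (\<forall>u\<in>carrier H. \<forall>v\<in>carrier H. ip H u (T v) = ip H (S u) v)"
proof -
  note TD = bounded_operatorD[OF T]
  obtain B where B0: "B \<ge> 0" and B: "\<And>u. u \<in> carrier H \<Longrightarrow> hnorm H (T u) \<le> B * hnorm H u"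
    using bounded_operator_pos_bound[OF T] by blast
  have "\<exists>z\<in>carrier H. \<forall>v\<in>carrier H. ip H u (T v) = ip H z v" if u: "u \<in> carrier H" for u
  proof -
    have "norm (ip H u (T v)) \<le> (hnorm H u * B) * hnorm H v" if "v \<in> carrier H" for v
    proof -
      have "norm (ip H u (T v)) \<le> hnorm H u * hnorm H (T v)"
        using u that TD by (intro cauchy_schwarz)
      also have "\<dots> \<le> hnorm H u * (B * hnorm H v)"
        using B[OF that] u by (simp add: mult_left_mono)
      finally show ?thesis by (simp add: mult.assoc)
    qed
    then obtain z where "z \<in> carrier H" "\<And>v. v \<in> carrier H \<Longrightarrow> ip H u (T v) = ip H z v"
      using u TD by (rule_tac riesz_representation[of "\<lambda>v. ip H u (T v)" "hnorm H u * B"])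
        (auto simp: ip_add ip_smult)
    then show ?thesis by blast
  qed
  then obtain S where S: "\<And>u. u \<in> carrier H \<Longrightarrow> S u \<in> carrier H"
    and adj: "\<And>u v. u \<in> carrier H \<Longrightarrow> v \<in> carrier H \<Longrightarrow> ip H u (T v) = ip H (S u) v"
    by metis
  have adj': "ip H v (S u) = ip H (T v) u" if "u \<in> carrier H" "v \<in> carrier H" for u v
    using that adj[of u v] ip_conjugate[of "S u" v] ip_conjugate[of u "T v"] S TD by simp
  have "S (u \<oplus>\<^bsub>H\<^esub> v) = S u \<oplus>\<^bsub>H\<^esub> S v" if "u \<in> carrier H" "v \<in> carrier H" for u v
    by (rule hilbert_eqI) (use that S TD in \<open>simp_all add: adj' ip_add\<close>)
  moreover have "S (c \<odot>\<^bsub>H\<^esub> u) = c \<odot>\<^bsub>H\<^esub> S u" if "u \<in> carrier H" for u c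
    by (rule hilbert_eqI) (use that S TD in \<open>simp_all add: adj' ip_smult\<close>)
  moreover have "hnorm H (S u) \<le> B * hnorm H u" if u: "u \<in> carrier H" for u
  proof (cases "hnorm H (S u) = 0")
    case False
    then have pos: "hnorm H (S u) > 0" using S[OF u] hnorm_nonneg by (metis less_eq_real_def)
    have "(hnorm H (S u))\<^sup>2 = norm (ip H (S u) (S u))"
      using S[OF u] by (simp add: ip_self norm_power)
    also have "\<dots> = norm (ip H u (T (S u)))" using u S by (simp add: adj)
    also have "\<dots> \<le> hnorm H u * hnorm H (T (S u))"
      using u S TD by (intro cauchy_schwarz) auto
    also have "\<dots> \<le> hnorm H u * (B * hnorm H (S u))"
      using B[OF S[OF u]] u by (simp add: mult_left_mono)
    finally show ?thesis using pos by (simp add: power2_eq_square ac_simps)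
  qed (use u B0 in simp)
  ultimately have "bounded_operator H S"
    unfolding bounded_operator_def module_hom_def using S by blast
  with adj show ?thesis by blast
qed

lemma
  assumes "bounded_operator H T"
  shows bounded_operator_adjoint_op: "bounded_operator H (adjoint_op H T)"
    and ip_adjoint_op: "u \<in> carrier H \<Longrightarrow> v \<in> carrier H \<Longrightarrow> ip H u (T v) = ip H (adjoint_op H T u) v"
  using someI_ex[OF adjoint_exists[OF assms]] unfolding adjoint_op_def by blast+

text \<open>Formulated at a single vector because the chosen adjoint is arbitrary off the carrier,
  so that an equality of functions cannot be expected.\<close>

lemma adjoint_op_unique:
  assumes T: "bounded_operator H T"
    and S: "u \<in> carrier H" "S u \<in> carrier H" "\<And>v. v \<in> carrier H \<Longrightarrow> ip H u (T v) = ip H (S u) v"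
  shows "adjoint_op H T u = S u"
proof (rule hilbert_eqI)
  show A: "adjoint_op H T u \<in> carrier H"
    using bounded_operator_closed[OF bounded_operator_adjoint_op[OF T]] S by blast
  show "ip H w (adjoint_op H T u) = ip H w (S u)" if "w \<in> carrier H" for w
    using that S A ip_adjoint_op[OF T, of u w] ip_conjugate[of "S u" w] ip_conjugate[of "adjoint_op H T u" w]
    by simp
qed fact

end

section \<open>Rank and independent columns\<close>

text \<open>\<open>B\<close> is a set of indices, not of vectors: two indices with equal columns are
  dependent here, whereas in a set of vectors they would collapse into one.\<close>

definition indep_columns :: "'i set \<Rightarrow> ('i \<Rightarrow> 'i \<Rightarrow> 'k::field) \<Rightarrow> 'i set \<Rightarrow> bool" where
  "indep_columns I M B \<longleftrightarrow> (\<forall>c. (\<forall>v\<in>I. (\<Sum>b\<in>B. M v b * c b) = 0) \<longrightarrow> (\<forall>b\<in>B. c b = 0))"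

context
  fixes I :: "'i set" and M :: "'i \<Rightarrow> 'i \<Rightarrow> 'k::field" and "is" :: "'i list" and n :: nat
  assumes "is": "distinct is" "set is = I" and n: "n = card I"
begin

definition col_vec :: "'i \<Rightarrow> 'k vec" where
  "col_vec w = vec n (\<lambda>a. M (is ! a) w)"

interpretation vec_space "TYPE('k)" n .

lemma col_vec_carrier: "col_vec ` B \<subseteq> carrier_vec n"
  by (auto simp: col_vec_def)

lemma length_enum: "length is = n"
  using "is" n distinct_card by metis

lemma enum_nth: "v \<in> I \<Longrightarrow> \<exists>i<n. v = is ! i"
  using "is"(2) by (auto simp: in_set_conv_nth length_enum)

lemma lincomb_col_vec:
  assumes "finite B" "inj_on col_vec B" "i < n"
  shows "lincomb a (col_vec ` B) $ i = (\<Sum>b\<in>B. M (is ! i) b * a (col_vec b))"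
proof -
  have "lincomb a (col_vec ` B) $ i = (\<Sum>x\<in>col_vec ` B. a x * x $ i)"
    using assms(3) col_vec_carrier by (rule lincomb_index)
  also have "\<dots> = (\<Sum>b\<in>B. a (col_vec b) * col_vec b $ i)"
    using assms(2) by (simp add: sum.reindex)
  finally show ?thesis
    using assms(3) by (simp add: col_vec_def mult.commute)
qed

text \<open>Equal columns at two indices would satisfy the relation with coefficients
  \<open>1\<close> and \<open>-1\<close>.\<close>

lemma indep_columns_inj:
  assumes "finite B" "indep_columns I M B"
  shows "inj_on col_vec B"
proof (rule inj_onI)
  fix a b assume ab: "a \<in> B" "b \<in> B" "col_vec a = col_vec b"
  show "a = b"
  proof (rule ccontr)
    assume ne: "a \<noteq> b"
    define c where "c x = (if x = a then 1 else if x = b then -1 else (0::'k))" for x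
    have "(\<Sum>x\<in>B. M v x * c x) = 0" if "v \<in> I" for v
    proof -
      obtain i where i: "i < n" "v = is ! i"
        using enum_nth[of v] \<open>v \<in> I\<close> by blast
      have "M v a = M v b"
        using arg_cong[OF ab(3), of "\<lambda>x. x $ i"] i by (simp add: col_vec_def)
      have "(\<Sum>x\<in>B. M v x * c x) = (\<Sum>x\<in>{a, b}. M v x * c x)"
        by (rule sum.mono_neutral_right) (use assms(1) ab in \<open>auto simp: c_def\<close>)
      also have "\<dots> = 0" using ne \<open>M v a = M v b\<close> by (simp add: c_def)
      finally show ?thesis .
    qed
    then have "c a = 0"
      using assms(2) ab unfolding indep_columns_def by blast
    then show False by (simp add: c_def)
  qed
qed

lemma indep_columns_imp_lin_indpt:
  assumes "finite B" "indep_columns I M B"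
  shows "lin_indpt (col_vec ` B)"
proof (rule finite_lin_indpt2)
  fix a assume a: "lincomb a (col_vec ` B) = 0\<^sub>v n"
  have "(\<Sum>b\<in>B. M v b * a (col_vec b)) = 0" if "v \<in> I" for v
  proof -
    obtain i where i: "i < n" "v = is ! i"
      using enum_nth[of v] \<open>v \<in> I\<close> by blast
    then show ?thesis
      using lincomb_col_vec[OF assms(1) indep_columns_inj[OF assms] i(1), of a] a by simp
  qed
  then have "\<forall>b\<in>B. a (col_vec b) = 0"
    using assms(2)[unfolded indep_columns_def, rule_format, of "\<lambda>b. a (col_vec b)"] by blast
  then show "\<forall>v\<in>col_vec ` B. a v = 0" by blast
qed (use assms(1) col_vec_carrier in auto)

lemma lin_indpt_imp_indep_columns:
  assumes "finite B" "inj_on col_vec B" "lin_indpt (col_vec ` B)"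
  shows "indep_columns I M B"
  unfolding indep_columns_def
proof (intro allI impI)
  fix c assume c: "\<forall>v\<in>I. (\<Sum>b\<in>B. M v b * c b) = 0"
  define a where "a x = c (inv_into B col_vec x)" for x
  have ac: "a (col_vec b) = c b" if "b \<in> B" for b
    using that assms(2) by (simp add: a_def)
  have "lincomb a (col_vec ` B) = 0\<^sub>v n"
  proof (rule eq_vecI)
    fix i assume "i < dim_vec (0\<^sub>v n :: 'k vec)"
    then have i: "i < n" by simp
    then have "is ! i \<in> I" using "is" length_enum by auto
    then show "lincomb a (col_vec ` B) $ i = 0\<^sub>v n $ i"
      using c i by (simp add: lincomb_col_vec[OF assms(1,2) i] ac)
  qed (use assms(1) col_vec_carrier in \<open>simp add: lincomb_dim\<close>)
  then have "a \<in> col_vec ` B \<rightarrow> {0}"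
    using not_lindepD[OF assms(3), of "col_vec ` B" a] assms(1) by simp
  then have "a (col_vec b) = 0" if "b \<in> B" for b
    using that by (auto dest: funcset_mem[of _ _ _ "col_vec b"])
  then show "\<forall>b\<in>B. c b = 0" using ac by simp
qed

lemma cols_enum: "cols (mat n n (\<lambda>(a, b). M (is ! a) (is ! b))) = map col_vec is"
  by (rule nth_equalityI) (auto simp: length_enum col_vec_def col_def)

lemma ex_indep_columns_rank:
  "\<exists>B\<subseteq>I. card B = rank (mat n n (\<lambda>(a, b). M (is ! a) (is ! b))) \<and> indep_columns I M B"
proof -
  let ?A = "mat n n (\<lambda>(a, b). M (is ! a) (is ! b))"
  let ?P = "\<lambda>T. T \<subseteq> set (cols ?A) \<and> lin_indpt T"
  obtain U where U: "maximal U ?P"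
    using maximal_exists_superset[of "set (cols ?A)" ?P "{}"] finite_lin_indpt2[of "{}"] by auto
  then have "rank ?A = card U" by (intro rank_card_indpt) auto
  moreover have "U \<subseteq> col_vec ` I" "lin_indpt U"
    using U unfolding maximal_def cols_enum using "is" by auto
  \<comment> \<open>One index is kept for each vector in \<open>U\<close>.\<close>
  moreover obtain B where "B \<subseteq> I" "inj_on col_vec B" "col_vec ` B = U"
    using \<open>U \<subseteq> col_vec ` I\<close> by (metis subset_image_inj)
  moreover from this have "finite B" using "is" finite_subset[of B I] by auto
  moreover from calculation have "indep_columns I M B"
    by (intro lin_indpt_imp_indep_columns) simp_all
  moreover from calculation have "card B = rank ?A"
    using card_image[of col_vec B] by simp
  ultimately show ?thesis by blast
qed

text \<open>A column outside the span would extend \<open>B\<close> to an independent set with more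
  elements than the rank allows.\<close>

lemma indep_columns_span_of_rank:
  assumes B: "B \<subseteq> I" "indep_columns I M B"
    and card: "card B = rank (mat n n (\<lambda>(a, b). M (is ! a) (is ! b)))"
    and w: "w \<in> I"
  shows "\<exists>c. \<forall>v\<in>I. M v w = (\<Sum>b\<in>B. M v b * c b)"
proof -
  have finB: "finite B" using B "is" finite_subset by blast
  note inj = indep_columns_inj[OF finB B(2)] and li = indep_columns_imp_lin_indpt[OF finB B(2)]
  have carr: "col_vec w \<in> carrier_vec n" by (simp add: col_vec_def)
  have "col_vec w \<in> span (col_vec ` B)"
  proof (cases "col_vec w \<in> col_vec ` B")
    case True
    then show ?thesis using span_mem col_vec_carrier by auto
  next
    case False
    have "lin_dep (col_vec ` B \<union> {col_vec w})"
    proof (rule ccontr)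
      assume "\<not> lin_dep (col_vec ` B \<union> {col_vec w})"
      moreover have "col_vec ` B \<union> {col_vec w} \<subseteq> set (cols (mat n n (\<lambda>(a, b). M (is ! a) (is ! b))))"
        using B w "is" by (auto simp: cols_enum)
      ultimately have "card (col_vec ` B \<union> {col_vec w}) \<le> card B"
        unfolding card by (intro rank_ge_card_indpt) auto
      then show False using False finB inj by (simp add: card_image)
    qed
    then show ?thesis
      using lin_dep_iff_in_span[of "col_vec ` B" "col_vec w"] col_vec_carrier carr li False by simp
  qed
  then obtain a where a: "col_vec w = lincomb a (col_vec ` B)"
    using finite_span[of "col_vec ` B"] finB col_vec_carrier by auto
  have "M v w = (\<Sum>b\<in>B. M v b * a (col_vec b))" if "v \<in> I" for v
  proof -
    obtain i where i: "i < n" "v = is ! i"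
      using enum_nth[of v] \<open>v \<in> I\<close> by blast
    then show ?thesis
      using lincomb_col_vec[OF finB inj i(1), of a] unfolding a[symmetric] by (simp add: col_vec_def)
  qed
  then show ?thesis
    by (intro exI[of _ "\<lambda>b. a (col_vec b)"] ballI)
qed

end

lemma matrix_rank_enum:
  assumes "finite I"
  obtains "is" where "distinct is" "set is = I"
    "\<And>M :: 'i \<Rightarrow> 'i \<Rightarrow> 'k::field. matrix_rank I M =
       vec_space.rank (card I) (mat (card I) (card I) (\<lambda>(a, b). M (is ! a) (is ! b)))"
proof -
  have "\<exists>is. distinct is \<and> set is = I"
    using finite_distinct_list[OF assms] by blast
  then have "distinct (SOME is. distinct is \<and> set is = I) \<and> set (SOME is. distinct is \<and> set is = I) = I"
    by (rule someI_ex)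
  then show thesis
    by (intro that) (auto simp: matrix_rank_def Let_def)
qed

lemma matrix_rank_ex_indep_columns:
  assumes "finite I"
  obtains B where "B \<subseteq> I" "card B = matrix_rank I M" "indep_columns I M B"
proof -
  obtain "is" where en: "distinct is" "set is = I" and
    rk: "matrix_rank I M = vec_space.rank (card I) (mat (card I) (card I) (\<lambda>(a, b). M (is ! a) (is ! b)))"
    using matrix_rank_enum[OF assms, of thesis] by blast
  show thesis
    using ex_indep_columns_rank[OF en refl, of M, folded rk] that by blast
qed

lemma matrix_rank_indep_columns_span:
  assumes "finite I" "B \<subseteq> I" "indep_columns I M B" "card B = matrix_rank I M" "w \<in> I"
  obtains c where "\<And>v. v \<in> I \<Longrightarrow> M v w = (\<Sum>b\<in>B. M v b * c b)"
proof -
  obtain "is" where "distinct is" "set is = I" and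
    rk: "matrix_rank I M = vec_space.rank (card I) (mat (card I) (card I) (\<lambda>(a, b). M (is ! a) (is ! b)))"
    using matrix_rank_enum[OF assms(1), of thesis] by blast
  from indep_columns_span_of_rank[OF this(1,2) refl assms(2,3) assms(4)[unfolded rk] assms(5)] that
  show thesis by blast
qed

text \<open>Columns that are independent on a principal submatrix stay independent on the whole matrix.\<close>

lemma flat_matrix_basis:
  assumes T: "finite T" "S \<subseteq> T" and rank: "matrix_rank T M = matrix_rank S M"
  obtains B where "B \<subseteq> S" "card B = matrix_rank S M" "indep_columns T M B"
    "\<And>w. w \<in> T \<Longrightarrow> \<exists>c. \<forall>v\<in>T. M v w = (\<Sum>b\<in>B. M v b * c b)"
proof -
  obtain B where B: "B \<subseteq> S" "card B = matrix_rank S M" "indep_columns S M B"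
    using matrix_rank_ex_indep_columns[OF finite_subset[OF T(2,1)], of M] by blast
  moreover have ind: "indep_columns T M B"
    using B(3) T(2) unfolding indep_columns_def by blast
  \<comment> \<open>By the rank hypothesis \<open>card B\<close> is also the rank over
    \<open>T\<close>, and independent columns in that number span all columns.\<close>
  moreover have "\<exists>c. \<forall>v\<in>T. M v w = (\<Sum>b\<in>B. M v b * c b)" if "w \<in> T" for w
    using matrix_rank_indep_columns_span[OF T(1) subset_trans[OF B(1) T(2)] ind _ that] B(2) rank by metis
  ultimately show thesis using that by blast
qed

section \<open>Words and the Riesz functional\<close>

lemma letter_star_letter_star [simp]: "letter_star (letter_star l) = l"
  by (cases l) auto

lemma word_star_Nil [simp]: "word_star [] = []"
  by (simp add: word_star_def)

lemma word_star_Cons: "word_star (l # w) = word_star w @ [letter_star l]"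
  by (simp add: word_star_def)

lemma word_star_append: "word_star (v @ w) = word_star w @ word_star v"
  by (simp add: word_star_def)

lemma word_star_word_star [simp]: "word_star (word_star w) = w"
  by (induction w) (simp_all add: word_star_Cons word_star_append)

lemma length_word_star [simp]: "length (word_star w) = length w"
  by (simp add: word_star_def)

lemma finite_words: "finite (words j :: 'n::finite ncword set)"
  using finite_lists_length_le[of "UNIV :: 'n letter set" j] by (simp add: words_def)

lemma riesz_superset:
  assumes "finite A" "Poly_Mapping.keys f \<subseteq> A"
  shows "riesz y f = (\<Sum>w\<in>A. Poly_Mapping.lookup f w * y w)"
  unfolding riesz_def
  by (rule sum.mono_neutral_left) (use assms in \<open>auto simp: in_keys_iff\<close>)

lemma riesz_add: "riesz y (f + g) = riesz y f + riesz y g"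
proof -
  let ?A = "Poly_Mapping.keys f \<union> Poly_Mapping.keys g"
  have "riesz y (f + g) = (\<Sum>w\<in>?A. Poly_Mapping.lookup (f + g) w * y w)"
    using keys_add[of f g] by (intro riesz_superset) auto
  also have "\<dots> = riesz y f + riesz y g"
    by (simp add: riesz_superset[of ?A] lookup_add distrib_right sum.distrib)
  finally show ?thesis .
qed

lemma riesz_sum: "riesz y (\<Sum>a\<in>A. f a) = (\<Sum>a\<in>A. riesz y (f a))"
  by (induction A rule: infinite_finite_induct) (simp_all add: riesz_add riesz_def[of y 0])

lemma riesz_single: "riesz y (Poly_Mapping.single w c) = c * y w"
  by (simp add: riesz_def)

lemma poly_mapping_sum_single:
  "f = (\<Sum>u\<in>Poly_Mapping.keys f. Poly_Mapping.single u (Poly_Mapping.lookup f u))"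
  by (rule poly_mapping_eqI) (simp add: lookup_sum lookup_single when_def in_keys_iff)

lemma poly_star_word_poly: "poly_star (word_poly v) = word_poly (word_star v)"
  by (simp add: poly_star_def word_poly_def)

lemma moment_matrix_eq: "moment_matrix y v w = y (word_star v @ w)"
  unfolding moment_matrix_def poly_star_word_poly
  by (simp add: word_poly_def mult_single riesz_single plus_list_def)

lemma localizing_matrix_eq:
  "localizing_matrix q y v w =
     (\<Sum>u\<in>Poly_Mapping.keys q. Poly_Mapping.lookup q u * y (word_star v @ u @ w))"
proof -
  have "localizing_matrix q y v w = riesz y (word_poly (word_star v) *
      (\<Sum>u\<in>Poly_Mapping.keys q. Poly_Mapping.single u (Poly_Mapping.lookup q u)) * word_poly w)"
    unfolding localizing_matrix_def poly_star_word_poly by (subst poly_mapping_sum_single[of q]) (rule refl)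
  then show ?thesis
    by (simp add: word_poly_def sum_distrib_left sum_distrib_right mult_single riesz_sum riesz_single
        plus_list_def)
qed

section \<open>Operators\<close>

lemma word_op_Nil [simp]: "word_op H X [] u = u"
  by (simp add: word_op_def)

lemma word_op_Cons: "word_op H X (l # w) u = letter_op H X l (word_op H X w u)"
  by (simp add: word_op_def)

lemma word_op_append: "word_op H X (v @ w) u = word_op H X v (word_op H X w u)"
  by (induction v) (simp_all add: word_op_Cons)

context hilbert_space
begin

text \<open>The quadratic form of this matrix at \<open>c\<close> is the value
  \<open>\<langle>z, T z\<rangle>\<close> at the combination \<open>z\<close> of the vectors
  \<open>f v\<close>. The identity in place of \<open>T\<close> yields moment matrices, the operator
  of a constraint yields localizing matrices.\<close>

lemma positive_op_psd:
  assumes T: "positive_op H T" "\<And>u. u \<in> carrier H \<Longrightarrow> T u \<in> carrier H"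
    and f: "finite I" "\<And>v. v \<in> I \<Longrightarrow> f v \<in> carrier H"
  shows "matrix_psd I (\<lambda>v w. ip H (f v) (T (f w)))"
  unfolding matrix_psd_def
proof (intro conjI ballI allI)
  have sym: "ip H u (T v) = ip H (T u) v" if "u \<in> carrier H" "v \<in> carrier H" for u v
    using that T(1) unfolding positive_op_def by blast
  show "ip H (f v) (T (f w)) = conjugate (ip H (f w) (T (f v)))" if "v \<in> I" "w \<in> I" for v w
    using that f T(2) sym[of "f v" "f w"] ip_conjugate[of "f w" "T (f v)"] by simp
  fix c
  define z where "z = finsum H (\<lambda>v. c v \<odot>\<^bsub>H\<^esub> f v) I"
  have z: "z \<in> carrier H" unfolding z_def by (rule finsum_closed) (use f in auto)
  \<comment> \<open>Symmetry moves \<open>T\<close> to the other argument before \<open>z\<close> is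
    expanded, so no linearity of \<open>T\<close> enters.\<close>
  have "ip H z (T z) = (\<Sum>w\<in>I. c w * ip H z (T (f w)))"
    unfolding sym[OF z z] using f z T(2)
    by (subst (2) z_def, subst ip_finsum_right) (auto simp: ip_smult sym intro!: sum.cong)
  also have "\<dots> = (\<Sum>w\<in>I. c w * (\<Sum>v\<in>I. conjugate (c v) * ip H (f v) (T (f w))))"
    unfolding z_def using f T(2)
    by (intro sum.cong refl arg_cong2[where f = "(*)"], subst ip_finsum_left)
      (auto simp: ip_smult_left intro!: sum.cong)
  also have "\<dots> = (\<Sum>v\<in>I. \<Sum>w\<in>I. conjugate (c v) * ip H (f v) (T (f w)) * c w)"
    unfolding sum_distrib_left by (subst sum.swap) (simp add: ac_simps)
  finally show "0 \<le> (\<Sum>v\<in>I. \<Sum>w\<in>I. conjugate (c v) * ip H (f v) (T (f w)) * c w)"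
    using T(1) z unfolding positive_op_def by metis
qed

context
  fixes X :: "'n \<Rightarrow> 'u \<Rightarrow> 'u"
  assumes X: "\<And>i. bounded_operator H (X i)"
begin

lemma letter_op_bounded: "bounded_operator H (letter_op H X l)"
  using X bounded_operator_adjoint_op by (cases l) auto

lemma ip_letter_op:
  assumes "u \<in> carrier H" "v \<in> carrier H"
  shows "ip H u (letter_op H X l v) = ip H (letter_op H X (letter_star l) u) v"
proof (cases l)
  case (Var i)
  then show ?thesis using assms ip_adjoint_op[OF X] by simp
next
  case (VarStar i)
  have "adjoint_op H (X i) v \<in> carrier H" "X i u \<in> carrier H"
    using assms bounded_operator_closed X bounded_operator_adjoint_op by blast+
  then have "ip H u (adjoint_op H (X i) v) = ip H (X i u) v"
    using assms ip_conjugate[of "adjoint_op H (X i) v" u] ip_conjugate[of v "X i u"]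
      ip_adjoint_op[OF X, of v u i] by simp
  then show ?thesis using VarStar by simp
qed

lemma word_op_closed: "u \<in> carrier H \<Longrightarrow> word_op H X w u \<in> carrier H"
  by (induction w) (auto simp: word_op_Cons intro: bounded_operator_closed[OF letter_op_bounded])

lemma ip_word_op:
  "u \<in> carrier H \<Longrightarrow> v \<in> carrier H \<Longrightarrow> ip H u (word_op H X w v) = ip H (word_op H X (word_star w) u) v"
proof (induction w arbitrary: u)
  case (Cons l w)
  have "letter_op H X (letter_star l) u \<in> carrier H"
    using Cons.prems bounded_operator_closed[OF letter_op_bounded] by blast
  then show ?case
    using Cons by (simp add: word_op_Cons ip_letter_op word_op_closed word_star_Cons word_op_append)
qed simp

lemma poly_op_closed: "u \<in> carrier H \<Longrightarrow> poly_op H X p u \<in> carrier H"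
  unfolding poly_op_def by (rule finsum_closed) (simp add: word_op_closed)

lemma ip_poly_op:
  "u \<in> carrier H \<Longrightarrow> v \<in> carrier H \<Longrightarrow> ip H u (poly_op H X p v) =
     (\<Sum>w\<in>Poly_Mapping.keys p. Poly_Mapping.lookup p w * ip H u (word_op H X w v))"
  unfolding poly_op_def by (subst ip_finsum_right) (auto simp: word_op_closed ip_smult)

end

end

section \<open>The relaxation as a lower bound\<close>

lemma relaxation_feasible_moments:
  fixes q :: "nat \<Rightarrow> ('n::finite, 'k::real_or_complex) ncpoly" and H :: "('k, 'u) hilbert"
  assumes feas: "problem_feasible m q H X \<phi>"
  defines "y \<equiv> \<lambda>w. ip H \<phi> (word_op H X w \<phi>)"
  shows "relaxation_feasible k m q y"
    and "riesz y p = ip H \<phi> (poly_op H X p \<phi>)"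
proof -
  interpret hilbert_space H
    using feas by (simp add: problem_feasible_def)
  have X: "\<And>i. bounded_operator H (X i)" and \<phi>: "\<phi> \<in> carrier H" "hnorm H \<phi> = 1"
    and pos: "\<And>i. i \<in> {1..m} \<Longrightarrow> positive_op H (poly_op H X (q i))"
    using feas by (auto simp: problem_feasible_def)
  note closed = word_op_closed[of X, OF X]
  show "riesz y p = ip H \<phi> (poly_op H X p \<phi>)"
    using \<phi> X by (simp add: ip_poly_op riesz_def y_def)
  \<comment> \<open>As the starred word acts as the adjoint, the moment matrix is the Gram matrix of
    the vectors \<open>word_op H X w \<phi>\<close>.\<close>
  have y_append: "y (word_star v @ w) = ip H (word_op H X v \<phi>) (word_op H X w \<phi>)" for v w
    unfolding y_def word_op_append
    by (subst ip_word_op[OF X \<phi>(1) closed[OF \<phi>(1)]]) simp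
  have "moment_matrix y = (\<lambda>v w. ip H (word_op H X v \<phi>) (id (word_op H X w \<phi>)))"
    by (intro ext) (simp add: moment_matrix_eq y_append)
  moreover have "positive_op H id" using ip_nonneg by (auto simp: positive_op_def)
  ultimately have "matrix_psd (words k) (moment_matrix y)"
    using positive_op_psd[of id "words k" "\<lambda>v. word_op H X v \<phi>"] closed[OF \<phi>(1)]
    by (simp add: finite_words)
  moreover have "matrix_psd (words j) (localizing_matrix (q i) y)" if "i \<in> {1..m}" for i j
  proof -
    have "localizing_matrix (q i) y = (\<lambda>v w. ip H (word_op H X v \<phi>) (poly_op H X (q i) (word_op H X w \<phi>)))"
      by (intro ext) (simp add: localizing_matrix_eq y_append word_op_append ip_poly_op[of X, OF X] closed[OF \<phi>(1)])
    then show ?thesis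
      using positive_op_psd[OF pos[OF that] poly_op_closed[of X, OF X], of "words j" "\<lambda>v. word_op H X v \<phi>"]
        closed[OF \<phi>(1)] by (simp add: finite_words)
  qed
  moreover have "y [] = 1" using \<phi> by (simp add: y_def ip_self)
  ultimately show "relaxation_feasible k m q y"
    unfolding relaxation_feasible_def by blast
qed

lemma relaxation_value_le_problem_value:
  fixes q :: "nat \<Rightarrow> ('n::finite, 'k::real_or_complex) ncpoly"
  shows "relaxation_value k m q p \<le> problem_value TYPE('u) m q p"
  unfolding problem_value_def
proof (rule INF_greatest, clarify)
  fix H :: "('k, 'u) hilbert" and X :: "'n \<Rightarrow> 'u \<Rightarrow> 'u" and \<phi>
  assume feas: "problem_feasible m q H X \<phi>"
  show "relaxation_value k m q p \<le> ereal (problem_objective p H X \<phi>)"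
    unfolding relaxation_value_def problem_objective_def relaxation_feasible_moments(2)[OF feas, symmetric]
    by (rule INF_lower) (use relaxation_feasible_moments(1)[OF feas] in simp)
qed

section \<open>Finite-dimensional Hilbert spaces from Gram matrices\<close>

definition gram_form :: "nat \<Rightarrow> (nat \<Rightarrow> nat \<Rightarrow> 'k::real_or_complex) \<Rightarrow> 'k vec \<Rightarrow> 'k vec \<Rightarrow> 'k" where
  "gram_form r G x y = (\<Sum>i<r. \<Sum>j<r. conjugate (x $ i) * G i j * y $ j)"

text \<open>\<open>J\<close> copies the coordinate space into the type in which the Hilbert spaces
  of the problem live. The form is kept as a general Gram matrix, so no orthonormalization is
  required.\<close>

locale gram_space =
  fixes r :: nat and G :: "nat \<Rightarrow> nat \<Rightarrow> 'k::real_or_complex" and J :: "'k vec \<Rightarrow> 'u"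
  assumes inj_J: "inj_on J (carrier_vec r)"
    and G_hermitian: "\<lbrakk>i < r; j < r\<rbrakk> \<Longrightarrow> G i j = conjugate (G j i)"
    and form_nonneg: "x \<in> carrier_vec r \<Longrightarrow> 0 \<le> gram_form r G x x"
    and form_definite: "\<lbrakk>x \<in> carrier_vec r; gram_form r G x x = 0\<rbrakk> \<Longrightarrow> x = 0\<^sub>v r"
begin

definition coords :: "'u \<Rightarrow> 'k vec" where
  "coords = inv_into (carrier_vec r) J"

definition gram_hilbert :: "('k, 'u) hilbert" where
  "gram_hilbert = \<lparr> carrier = J ` carrier_vec r, mult = (\<lambda>u v. undefined), one = undefined,
     zero = J (0\<^sub>v r), add = (\<lambda>u v. J (coords u + coords v)),
     module.smult = (\<lambda>c u. J (c \<cdot>\<^sub>v coords u)), ip = (\<lambda>u v. gram_form r G (coords u) (coords v)) \<rparr>"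

lemma gram_hilbert_simps [simp]:
  "carrier gram_hilbert = J ` carrier_vec r"
  "\<zero>\<^bsub>gram_hilbert\<^esub> = J (0\<^sub>v r)"
  "u \<oplus>\<^bsub>gram_hilbert\<^esub> v = J (coords u + coords v)"
  "c \<odot>\<^bsub>gram_hilbert\<^esub> u = J (c \<cdot>\<^sub>v coords u)"
  "ip gram_hilbert u v = gram_form r G (coords u) (coords v)"
  by (simp_all add: gram_hilbert_def)

lemma coords_J [simp]: "x \<in> carrier_vec r \<Longrightarrow> coords (J x) = x"
  using inj_J by (simp add: coords_def)

lemma coords_carrier [simp]: "u \<in> J ` carrier_vec r \<Longrightarrow> coords u \<in> carrier_vec r"
  by auto

lemma gram_form_add_right:
  "\<lbrakk>y \<in> carrier_vec r; z \<in> carrier_vec r\<rbrakk> \<Longrightarrow> gram_form r G x (y + z) = gram_form r G x y + gram_form r G x z"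
  by (simp add: gram_form_def distrib_left sum.distrib)

lemma gram_form_smult_right:
  "y \<in> carrier_vec r \<Longrightarrow> gram_form r G x (c \<cdot>\<^sub>v y) = c * gram_form r G x y"
  by (simp add: gram_form_def sum_distrib_left ac_simps)

lemma gram_form_unit_left:
  assumes "i < r"
  shows "gram_form r G (unit_vec r i) x = (\<Sum>j<r. G i j * x $ j)"
proof -
  have "gram_form r G (unit_vec r i) x = (\<Sum>i'<r. if i' = i then \<Sum>j<r. G i' j * x $ j else 0)"
    unfolding gram_form_def using assms by (intro sum.cong refl) (simp add: unit_vec_def)
  then show ?thesis using assms by simp
qed

lemma gram_form_conjugate: "gram_form r G y x = conjugate (gram_form r G x y)"
proof -
  have "conjugate (gram_form r G x y) = (\<Sum>i<r. \<Sum>j<r. x $ i * conjugate (G i j) * conjugate (y $ j))"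
    by (simp add: gram_form_def sum_conjugate conjugate_dist_mul)
  also have "\<dots> = (\<Sum>j<r. \<Sum>i<r. conjugate (y $ j) * G j i * x $ i)"
    by (subst sum.swap) (intro sum.cong refl, simp add: ac_simps flip: G_hermitian)
  finally show ?thesis by (simp add: gram_form_def)
qed

lemma gram_vectorspace: "vectorspace class_ring gram_hilbert"
proof (rule vectorspace.intro)
  show "field (class_ring :: 'k ring)" by (rule class_field)
  show "module class_ring gram_hilbert"
  proof (rule moduleI)
    show "cring (class_ring :: 'k ring)" by (rule class_cring.cring_axioms)
    show "abelian_group gram_hilbert"
    proof (rule abelian_groupI)
      show "\<exists>y\<in>carrier gram_hilbert. y \<oplus>\<^bsub>gram_hilbert\<^esub> x = \<zero>\<^bsub>gram_hilbert\<^esub>"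
        if "x \<in> carrier gram_hilbert" for x
        by (rule bexI[of _ "J (- coords x)"]) (use that in auto)
    qed (auto simp: assoc_add_vec[of _ r] intro: arg_cong[OF comm_add_vec])
  qed (auto simp: add_smult_distrib_vec smult_add_distrib_vec[of _ r] smult_smult_assoc)
qed

sublocale inner_product_space gram_hilbert
proof (rule inner_product_space.intro[OF gram_vectorspace], rule inner_product_space_axioms.intro)
  fix u v w c
  assume u: "u \<in> carrier gram_hilbert"
  then have cu: "coords u \<in> carrier_vec r" by simp
  show "0 \<le> ip gram_hilbert u u"
    using form_nonneg[OF cu] by simp
  show "u = \<zero>\<^bsub>gram_hilbert\<^esub>" if "ip gram_hilbert u u = 0"
    using form_definite[OF cu] that u by auto
  assume v: "v \<in> carrier gram_hilbert"
  then have cv: "coords v \<in> carrier_vec r" by simp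
  show "ip gram_hilbert v u = conjugate (ip gram_hilbert u v)"
    using gram_form_conjugate[of "coords v" "coords u"] by simp
  show "ip gram_hilbert u (c \<odot>\<^bsub>gram_hilbert\<^esub> v) = c * ip gram_hilbert u v"
    using cv by (simp add: gram_form_smult_right)
  assume w: "w \<in> carrier gram_hilbert"
  then have cw: "coords w \<in> carrier_vec r" by simp
  show "ip gram_hilbert u (v \<oplus>\<^bsub>gram_hilbert\<^esub> w) = ip gram_hilbert u v + ip gram_hilbert u w"
    using cv cw by (simp add: gram_form_add_right)
qed

lemma coords_diff:
  assumes "u \<in> carrier gram_hilbert" "v \<in> carrier gram_hilbert" "i < r"
  shows "coords (u \<ominus>\<^bsub>gram_hilbert\<^esub> v) $ i = coords u $ i - coords v $ i"
proof -
  have "\<ominus>\<^bsub>gram_hilbert\<^esub> v = J ((-1) \<cdot>\<^sub>v coords v)"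
    using minus_conv_smult[OF assms(2)] by simp
  then show ?thesis using assms by (auto simp: a_minus_def)
qed

text \<open>Definiteness makes the Gram matrix \<open>A\<close> invertible. The entries of
  \<open>A\<close> applied to a coordinate vector are inner products with basis vectors, which
  Cauchy-Schwarz controls, and the inverse recovers the coordinates.\<close>

lemma coords_le_hnorm:
  obtains C where "C \<ge> 0"
    "\<And>u i. u \<in> carrier gram_hilbert \<Longrightarrow> i < r \<Longrightarrow> norm (coords u $ i) \<le> C * hnorm gram_hilbert u"
proof -
  define A where "A = mat r r (\<lambda>(i, j). G i j)"
  have A: "A \<in> carrier_mat r r" by (simp add: A_def)
  have Ax: "(A *\<^sub>v x) $ i = gram_form r G (unit_vec r i) x" if "x \<in> carrier_vec r" "i < r" for x i
    using that by (simp add: gram_form_unit_left A_def scalar_prod_def atLeast0LessThan)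
  \<comment> \<open>A nonzero kernel vector of \<open>A\<close> would be isotropic.\<close>
  have "det A \<noteq> 0"
  proof
    assume "det A = 0"
    then obtain v where v: "v \<in> carrier_vec r" "v \<noteq> 0\<^sub>v r" "A *\<^sub>v v = 0\<^sub>v r"
      using det_0_iff_vec_prod_zero[OF A] by blast
    have "(\<Sum>j<r. G i j * v $ j) = 0" if "i < r" for i
      using arg_cong[OF v(3), of "\<lambda>x. x $ i"] that v(1)
      by (simp add: A_def scalar_prod_def atLeast0LessThan)
    then have "gram_form r G v v = 0"
      by (simp add: gram_form_def mult.assoc flip: sum_distrib_left)
    with v form_definite show False by blast
  qed
  then obtain B where B: "B \<in> carrier_mat r r" "B * A = 1\<^sub>m r"
    using det_non_zero_imp_unit[OF A, of "TYPE('k)"] unfolding Units_def by (auto simp: ring_mat_def)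
  \<comment> \<open>The outer sum makes one constant serve all coordinates.\<close>
  define C where "C = (\<Sum>i<r. \<Sum>j<r. norm (B $$ (i, j)) * hnorm gram_hilbert (J (unit_vec r j)))"
  have nn: "0 \<le> norm (B $$ (i, j)) * hnorm gram_hilbert (J (unit_vec r j))" for i j
    by simp
  show thesis
  proof (rule that[of C])
    show "C \<ge> 0" unfolding C_def using nn by (intro sum_nonneg)
    fix u i assume u: "u \<in> carrier gram_hilbert" and i: "i < r"
    define x where "x = coords u"
    have x: "x \<in> carrier_vec r" "u = J x" using u by (auto simp: x_def)
    have "x = B *\<^sub>v (A *\<^sub>v x)"
      using assoc_mult_mat_vec[OF B(1) A x(1)] B(2) x(1) by simp
    then have "x $ i = (\<Sum>j<r. B $$ (i, j) * (A *\<^sub>v x) $ j)"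
      using i B(1) A x(1) by (metis (no_types, lifting) atLeast0LessThan carrier_matD(1,2) dim_mult_mat_vec
        index_mult_mat_vec index_row(1) lessThan_iff scalar_prod_def sum.cong)
    also have "norm \<dots> \<le> (\<Sum>j<r. norm (B $$ (i, j)) * hnorm gram_hilbert (J (unit_vec r j)) * hnorm gram_hilbert u)"
    proof (rule sum_norm_le)
      fix j assume "j \<in> {..<r}"
      then have "norm ((A *\<^sub>v x) $ j) \<le> hnorm gram_hilbert (J (unit_vec r j)) * hnorm gram_hilbert u"
        using cauchy_schwarz[of "J (unit_vec r j)" u] x by (simp add: Ax)
      then show "norm (B $$ (i, j) * (A *\<^sub>v x) $ j)
          \<le> norm (B $$ (i, j)) * hnorm gram_hilbert (J (unit_vec r j)) * hnorm gram_hilbert u"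
        by (simp add: norm_mult mult_left_mono mult.assoc)
    qed
    also have "\<dots> = (\<Sum>j<r. norm (B $$ (i, j)) * hnorm gram_hilbert (J (unit_vec r j))) * hnorm gram_hilbert u"
      by (simp add: sum_distrib_right)
    also have "\<dots> \<le> C * hnorm gram_hilbert u"
      unfolding C_def
      by (intro mult_right_mono hnorm_nonneg u member_le_sum[of i "{..<r}" "\<lambda>i. \<Sum>j<r. norm (B $$ (i, j)) * hnorm gram_hilbert (J (unit_vec r j))"])
        (use i nn in \<open>auto intro!: sum_nonneg\<close>)
    finally show "norm (coords u $ i) \<le> C * hnorm gram_hilbert u" by (simp add: x_def)
  qed
qed

text \<open>This passes from coordinates to the norm, \<open>coords_le_hnorm\<close> from the norm
  to coordinates; together they make convergence in norm coordinatewise.\<close>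

lemma hnorm_square_le:
  assumes u: "u \<in> carrier gram_hilbert"
  shows "(hnorm gram_hilbert u)\<^sup>2 \<le> (\<Sum>i<r. \<Sum>j<r. norm (coords u $ i) * norm (G i j) * norm (coords u $ j))"
proof -
  have "(hnorm gram_hilbert u)\<^sup>2 \<le> norm (gram_form r G (coords u) (coords u))"
    using hnorm_square_real_part[OF u] abs_real_part_le[of "ip gram_hilbert u u"] by simp
  also have "\<dots> \<le> (\<Sum>i<r. \<Sum>j<r. norm (coords u $ i) * norm (G i j) * norm (coords u $ j))"
    unfolding gram_form_def by (intro sum_norm_le) (simp add: norm_mult)
  finally show ?thesis .
qed

text \<open>A Cauchy sequence has Cauchy coordinates; their limits are the coordinates of the
  limit.\<close>

sublocale hilbert_space gram_hilbert
proof (rule hilbert_space.intro[OF gram_vectorspace], rule hilbert_space_axioms.intro)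
  interpret M: Metric_space "carrier gram_hilbert" "hdist gram_hilbert" by (rule Metric_space)
  obtain C where C: "C \<ge> 0"
    "\<And>u i. u \<in> carrier gram_hilbert \<Longrightarrow> i < r \<Longrightarrow> norm (coords u $ i) \<le> C * hnorm gram_hilbert u"
    using coords_le_hnorm by blast
  show "M.mcomplete"
    unfolding M.mcomplete_def
  proof (intro allI impI)
    fix \<sigma> assume cau: "M.MCauchy \<sigma>"
    have \<sigma>: "\<sigma> n \<in> carrier gram_hilbert" for n
      using cau unfolding M.MCauchy_def by blast
    have "\<exists>l. (\<lambda>n. coords (\<sigma> n) $ i) \<longlonglongrightarrow> l" if i: "i < r" for i
    proof (rule convergent_scalar, rule CauchyI)
      fix e :: real assume e: "e > 0"
      then have "e / (C + 1) > 0" using C(1) by simp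
      then obtain N where N: "\<And>m n. m \<ge> N \<Longrightarrow> n \<ge> N \<Longrightarrow> hdist gram_hilbert (\<sigma> m) (\<sigma> n) < e / (C + 1)"
        using cau unfolding M.MCauchy_def by meson
      have "norm (coords (\<sigma> m) $ i - coords (\<sigma> n) $ i) < e" if "m \<ge> N" "n \<ge> N" for m n
      proof -
        have "norm (coords (\<sigma> m) $ i - coords (\<sigma> n) $ i) \<le> C * hdist gram_hilbert (\<sigma> m) (\<sigma> n)"
          using C(2)[of "\<sigma> m \<ominus>\<^bsub>gram_hilbert\<^esub> \<sigma> n" i] \<sigma> i
          by (simp add: coords_diff hdist_def del: gram_hilbert_simps)
        also have "\<dots> \<le> (C + 1) * hdist gram_hilbert (\<sigma> m) (\<sigma> n)"
          by (simp add: mult_right_mono)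
        also have "\<dots> < e"
          using N[OF that] C(1) by (simp add: pos_less_divide_eq mult.commute)
        finally show ?thesis .
      qed
      then show "\<exists>M. \<forall>m\<ge>M. \<forall>n\<ge>M. norm (coords (\<sigma> m) $ i - coords (\<sigma> n) $ i) < e" by blast
    qed
    then obtain l where l: "\<And>i. i < r \<Longrightarrow> (\<lambda>n. coords (\<sigma> n) $ i) \<longlonglongrightarrow> l i" by metis
    define z where "z = J (vec r l)"
    have z: "z \<in> carrier gram_hilbert" by (simp add: z_def)
    define D where "D n i = norm (coords (\<sigma> n) $ i - l i)" for n i
    have D: "(\<lambda>n. D n i) \<longlonglongrightarrow> 0" if "i < r" for i
      unfolding D_def using l[OF that] by (simp add: LIM_zero tendsto_norm_zero)
    have "(\<lambda>n. \<Sum>i<r. \<Sum>j<r. D n i * norm (G i j) * D n j) \<longlonglongrightarrow> (\<Sum>i<r. \<Sum>j<r. 0 * norm (G i j) * 0)"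
      by (intro tendsto_sum tendsto_mult tendsto_const D) auto
    then have lim: "(\<lambda>n. \<Sum>i<r. \<Sum>j<r. D n i * norm (G i j) * D n j) \<longlonglongrightarrow> 0" by simp
    have "(hnorm gram_hilbert (\<sigma> n \<ominus>\<^bsub>gram_hilbert\<^esub> z))\<^sup>2 \<le> (\<Sum>i<r. \<Sum>j<r. D n i * norm (G i j) * D n j)" for n
    proof -
      have "coords (\<sigma> n \<ominus>\<^bsub>gram_hilbert\<^esub> z) $ i = coords (\<sigma> n) $ i - l i" if "i < r" for i
        using coords_diff[OF \<sigma> z that] that by (simp add: z_def)
      then show ?thesis
        using hnorm_square_le[of "\<sigma> n \<ominus>\<^bsub>gram_hilbert\<^esub> z"] \<sigma> z
        by (simp add: D_def del: gram_hilbert_simps)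
    qed
    then have "(\<lambda>n. (hnorm gram_hilbert (\<sigma> n \<ominus>\<^bsub>gram_hilbert\<^esub> z))\<^sup>2) \<longlonglongrightarrow> 0"
      by (intro tendsto_sandwich[OF _ _ tendsto_const lim]) auto
    then have "(\<lambda>n. sqrt ((hnorm gram_hilbert (\<sigma> n \<ominus>\<^bsub>gram_hilbert\<^esub> z))\<^sup>2)) \<longlonglongrightarrow> sqrt 0"
      by (rule tendsto_real_sqrt)
    then have "(\<lambda>n. hdist gram_hilbert (\<sigma> n) z) \<longlonglongrightarrow> 0"
      using \<sigma> z by (simp add: hdist_def del: gram_hilbert_simps)
    then have "limitin M.mtopology \<sigma> z sequentially"
      unfolding M.limitin_metric_dist_null using \<sigma> z by (simp del: gram_hilbert_simps)
    then show "\<exists>x. limitin M.mtopology \<sigma> x sequentially" by blast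
  qed
qed (fact ip_add ip_smult ip_conjugate ip_nonneg ip_definite)+

text \<open>The matrix refers to the basis whose Gram matrix is \<open>G\<close>. As that basis need
  not be orthonormal, the conjugate transpose of \<open>a\<close> need not represent the
  adjoint.\<close>

definition gram_op :: "(nat \<Rightarrow> nat \<Rightarrow> 'k) \<Rightarrow> 'u \<Rightarrow> 'u" where
  "gram_op a u = J (vec r (\<lambda>i. \<Sum>j<r. a i j * coords u $ j))"

lemma gram_op_closed [simp]: "gram_op a u \<in> J ` carrier_vec r"
  by (simp add: gram_op_def)

lemma coords_gram_op [simp]: "i < r \<Longrightarrow> coords (gram_op a u) $ i = (\<Sum>j<r. a i j * coords u $ j)"
  by (simp add: gram_op_def)

lemma gram_op_bounded: "bounded_operator gram_hilbert (gram_op a)"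
proof -
  have "gram_op a (u \<oplus>\<^bsub>gram_hilbert\<^esub> v) = gram_op a u \<oplus>\<^bsub>gram_hilbert\<^esub> gram_op a v"
    if "u \<in> carrier gram_hilbert" "v \<in> carrier gram_hilbert" for u v
    using that by (auto simp: gram_op_def distrib_left sum.distrib intro!: arg_cong[of _ _ J] eq_vecI)
  moreover have "gram_op a (c \<odot>\<^bsub>gram_hilbert\<^esub> u) = c \<odot>\<^bsub>gram_hilbert\<^esub> gram_op a u"
    if "u \<in> carrier gram_hilbert" for u c
    using that by (auto simp: gram_op_def sum_distrib_left ac_simps intro!: arg_cong[of _ _ J] eq_vecI)
  moreover have "\<exists>B. \<forall>u\<in>carrier gram_hilbert. hnorm gram_hilbert (gram_op a u) \<le> B * hnorm gram_hilbert u"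
  proof -
    obtain C where C: "C \<ge> 0"
      "\<And>u i. u \<in> carrier gram_hilbert \<Longrightarrow> i < r \<Longrightarrow> norm (coords u $ i) \<le> C * hnorm gram_hilbert u"
      using coords_le_hnorm by blast
    \<comment> \<open>\<open>E\<close> bounds the coordinates of the image by the norm of the
      argument, and \<open>sqrt g\<close> leads from coordinates back to the norm.\<close>
    define E where "E = (\<Sum>i<r. \<Sum>j<r. norm (a i j)) * C"
    define g where "g = (\<Sum>i<r. \<Sum>j<r. norm (G i j))"
    have E: "E \<ge> 0" and g: "g \<ge> 0" using C(1) by (auto simp: E_def g_def intro!: mult_nonneg_nonneg sum_nonneg)
    have "hnorm gram_hilbert (gram_op a u) \<le> (sqrt g * E) * hnorm gram_hilbert u"
      if u: "u \<in> carrier gram_hilbert" for u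
    proof -
      define w where "w = gram_op a u"
      define t where "t = E * hnorm gram_hilbert u"
      have t: "t \<ge> 0" using E u by (simp add: t_def del: gram_hilbert_simps)
      have w: "w \<in> carrier gram_hilbert" by (simp add: w_def)
      have wt: "norm (coords w $ i) \<le> t" if i: "i < r" for i
      proof -
        have "norm (coords w $ i) \<le> (\<Sum>j<r. norm (a i j) * (C * hnorm gram_hilbert u))"
          unfolding w_def coords_gram_op[OF i]
          by (intro sum_norm_le) (use C(2)[OF u] in \<open>simp add: norm_mult mult_left_mono del: gram_hilbert_simps\<close>)
        also have "\<dots> = (\<Sum>j<r. norm (a i j)) * (C * hnorm gram_hilbert u)"
          by (simp add: sum_distrib_right)
        also have "\<dots> \<le> (\<Sum>i<r. \<Sum>j<r. norm (a i j)) * (C * hnorm gram_hilbert u)"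
          by (intro mult_right_mono member_le_sum[of i "{..<r}" "\<lambda>i. \<Sum>j<r. norm (a i j)"] mult_nonneg_nonneg C hnorm_nonneg u)
            (use i in \<open>auto intro!: sum_nonneg\<close>)
        finally show ?thesis by (simp add: t_def E_def mult.assoc)
      qed
      have "(hnorm gram_hilbert w)\<^sup>2 \<le> (\<Sum>i<r. \<Sum>j<r. norm (coords w $ i) * norm (G i j) * norm (coords w $ j))"
        by (rule hnorm_square_le[OF w])
      also have "\<dots> \<le> (\<Sum>i<r. \<Sum>j<r. t * norm (G i j) * t)"
        by (intro sum_mono mult_mono mult_nonneg_nonneg wt t) auto
      also have "\<dots> = (sqrt g * t)\<^sup>2"
        using g by (simp add: g_def power_mult_distrib power2_eq_square sum_distrib_left sum_distrib_right ac_simps)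
      finally have "hnorm gram_hilbert w \<le> sqrt g * t"
        by (rule power2_le_imp_le) (use g t in simp)
      then show ?thesis by (simp add: w_def t_def mult.assoc)
    qed
    then show ?thesis by blast
  qed
  ultimately show ?thesis
    unfolding bounded_operator_def module_hom_def by simp
qed

text \<open>\<open>J\<close> is a linear isomorphism from the coordinate space.\<close>

lemma gram_dim: "vectorspace.fin_dim class_ring gram_hilbert" "vectorspace.dim class_ring gram_hilbert = r"
proof -
  interpret V: vec_space "TYPE('k)" r .
  interpret L: linear_map "class_ring :: 'k ring" "module_vec TYPE('k) r" gram_hilbert J
  proof (intro linear_map.intro mod_hom.intro mod_hom_axioms.intro vec_vs gram_vectorspace)
    show "module class_ring gram_hilbert" using gram_vectorspace by (rule vectorspace.axioms)
    show "module class_ring (module_vec TYPE('k) r)" by (rule vec_module)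
    show "J \<in> module_hom class_ring (module_vec TYPE('k) r) gram_hilbert"
      by (auto simp: module_hom_def module_vec_simps)
  qed
  have surj: "J ` carrier (module_vec TYPE('k) r) = carrier gram_hilbert" by (simp add: module_vec_simps)
  show "vectorspace.fin_dim class_ring gram_hilbert"
    using L.surj_fin_dim[OF V.fin_dim surj] .
  show "vectorspace.dim class_ring gram_hilbert = r"
    using L.dim_eq[OF V.fin_dim _ surj] inj_J V.dim_is_n by (simp add: module_vec_simps)
qed

end

text \<open>Coordinate vectors are indexed by numbers, so the basis is put into a list and its
  relations are rewritten over positions.\<close>

lemma flat_matrix_basis_list:
  assumes "finite T" "S \<subseteq> T" and "matrix_rank T M = matrix_rank S M"
  obtains bs where "distinct bs" "set bs \<subseteq> S" "length bs = matrix_rank S M"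
    "\<And>c. \<forall>v\<in>T. (\<Sum>j<length bs. M v (bs ! j) * c j) = 0 \<Longrightarrow> \<forall>j<length bs. c j = 0"
    "\<And>w. w \<in> T \<Longrightarrow> \<exists>c. \<forall>v\<in>T. M v w = (\<Sum>j<length bs. M v (bs ! j) * c j)"
proof -
  obtain B where B: "B \<subseteq> S" "card B = matrix_rank S M" "indep_columns T M B"
    and span: "\<And>w. w \<in> T \<Longrightarrow> \<exists>c. \<forall>v\<in>T. M v w = (\<Sum>b\<in>B. M v b * c b)"
    using flat_matrix_basis[OF assms] by blast
  have "finite B" by (rule finite_subset[OF subset_trans[OF B(1) assms(2)] assms(1)])
  then obtain bs where bs: "set bs = B" "distinct bs"
    using finite_distinct_list[of B] by blast
  have bij: "bij_betw (nth bs) {..<length bs} B"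
    using bs by (intro bij_betw_nth) auto
  note reindex = sum.reindex_bij_betw[OF bij, symmetric]
  show thesis
  proof (rule that)
    show "length bs = matrix_rank S M"
      using distinct_card[OF bs(2)] bs(1) B(2) by simp
    show "\<forall>j<length bs. c j = 0" if c: "\<forall>v\<in>T. (\<Sum>j<length bs. M v (bs ! j) * c j) = 0" for c
    proof -
      define c' where "c' b = c (inv_into {..<length bs} (nth bs) b)" for b
      have c': "c' (bs ! j) = c j" if "j < length bs" for j
        using that bij unfolding c'_def by (simp add: bij_betw_inv_into_left)
      have "(\<Sum>b\<in>B. M v b * c' b) = (\<Sum>j<length bs. M v (bs ! j) * c j)" for v
        by (simp add: reindex c')
      then have "\<forall>v\<in>T. (\<Sum>b\<in>B. M v b * c' b) = 0"
        using c by simp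
      then have "\<forall>b\<in>B. c' b = 0"
        using B(3)[unfolded indep_columns_def, THEN spec, of c'] by (rule rev_mp)
      then show ?thesis using c' nth_mem[of _ bs] bs(1) by auto
    qed
    show "\<exists>c. \<forall>v\<in>T. M v w = (\<Sum>j<length bs. M v (bs ! j) * c j)" if w: "w \<in> T" for w
    proof -
      obtain c where "\<forall>v\<in>T. M v w = (\<Sum>b\<in>B. M v b * c b)" using span[OF w] by blast
      then show ?thesis
        by (intro exI[of _ "\<lambda>j. c (bs ! j)"]) (simp add: reindex)
    qed
  qed (use bs B(1) in auto)
qed

section \<open>Positive semidefinite matrices\<close>

text \<open>An isotropic vector of a positive semidefinite form lies in its kernel: with
  \<open>N\<close> the image of \<open>c\<close> under the matrix and \<open>S\<close> its squared
  length, the form at \<open>c - t * N\<close> is \<open>t\<^sup>2 * a - 2 * t * S\<close>, which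
  can stay nonnegative for all \<open>t\<close> only if \<open>S\<close> vanishes.\<close>

lemma matrix_psd_kernel:
  assumes T: "finite T" and psd: "matrix_psd T M"
    and zero: "(\<Sum>v\<in>T. \<Sum>w\<in>T. conjugate (c v) * M v w * c w) = 0"
    and v: "v \<in> T"
  shows "(\<Sum>w\<in>T. M v w * c w) = 0"
proof -
  define Q where "Q f g = (\<Sum>v\<in>T. \<Sum>w\<in>T. conjugate (f v) * M v w * g w)" for f g
  define N where "N v = (\<Sum>w\<in>T. M v w * c w)" for v
  define S where "S = (\<Sum>v\<in>T. (norm (N v))\<^sup>2)"
  have herm: "conjugate (M w v) = M v w" if "v \<in> T" "w \<in> T" for v w
    using psd that unfolding matrix_psd_def by metis
  have pos: "0 \<le> Q f f" for f
    using psd unfolding matrix_psd_def Q_def by blast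
  have Q_right: "Q f (\<lambda>v. g v - of_real t * h v) = Q f g - of_real t * Q f h" for f g h t
    unfolding Q_def sum_distrib_left sum_subtractf[symmetric]
    by (intro sum.cong refl) (simp add: algebra_simps)
  have Q_left: "Q (\<lambda>v. g v - of_real t * h v) f = Q g f - of_real t * Q h f" for f g h t
    unfolding Q_def sum_distrib_left sum_subtractf[symmetric]
    by (intro sum.cong refl) (simp add: conjugate_diff conjugate_dist_mul conjugate_of_real algebra_simps)
  have Q_conj: "conjugate (Q f g) = Q g f" for f g
  proof -
    have "conjugate (Q f g) = (\<Sum>v\<in>T. \<Sum>w\<in>T. f v * conjugate (M v w) * conjugate (g w))"
      using T by (simp add: Q_def sum_conjugate conjugate_dist_mul)
    also have "\<dots> = Q g f"
      unfolding Q_def by (subst sum.swap) (intro sum.cong refl, simp add: herm ac_simps)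
    finally show ?thesis .
  qed
  have QN: "Q N c = of_real S"
  proof -
    have "(\<Sum>w\<in>T. a * M v w * c w) = N v * a" for v a
      by (simp add: N_def sum_distrib_left sum_distrib_right ac_simps)
    then have "Q N c = (\<Sum>v\<in>T. N v * conjugate (N v))"
      by (simp add: Q_def)
    then show ?thesis by (simp add: mult_conjugate_norm S_def)
  qed
  moreover have "Q c N = of_real S"
    using Q_conj[of N c] QN by (simp add: conjugate_of_real)
  moreover have "Q c c = 0" using zero by (simp add: Q_def)
  ultimately have expand: "Q (\<lambda>v. c v - of_real t * N v) (\<lambda>v. c v - of_real t * N v)
      = of_real t * (of_real t * Q N N) - of_real (2 * t * S)" for t
    unfolding Q_left Q_right by (simp add: algebra_simps)
  define a where "a = real_part (Q N N)"
  have a: "a \<ge> 0" unfolding a_def by (rule real_part_nonneg[OF pos])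
  have var: "0 \<le> t * (t * a) - 2 * t * S" for t
    using real_part_nonneg[OF pos, of "\<lambda>v. c v - of_real t * N v"]
    unfolding expand real_part_diff real_part_of_real_mult real_part_of_real a_def[symmetric] by simp
  \<comment> \<open>At \<open>t = s\<close> the form equals \<open>- (s\<^sup>2 * (a + 2))\<close>;
    the \<open>+ 1\<close> covers \<open>a = 0\<close>.\<close>
  define s where "s = S / (a + 1)"
  have s: "S = s * (a + 1)" using a by (simp add: s_def)
  have "0 \<le> - (s\<^sup>2 * (a + 2))"
    using var[of s] by (simp add: s algebra_simps power2_eq_square)
  then have "s = 0" using a by (simp add: mult_le_0_iff)
  then have "S = 0" using s by simp
  then have "(norm (N v))\<^sup>2 = 0"
    using T v unfolding S_def by (subst (asm) sum_nonneg_eq_0_iff) auto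
  then show ?thesis by (simp add: N_def)
qed

text \<open>The function \<open>c\<close> is \<open>x\<close> extended by zero from the listed
  indices. Both equations are for the same \<open>c\<close>, so that they can be applied to the two
  arguments of one form.\<close>

lemma sum_list_support:
  fixes x :: "nat \<Rightarrow> 'k::real_or_complex"
  assumes "finite T" "distinct bs" "set bs \<subseteq> T"
  obtains c where "\<And>f. (\<Sum>w\<in>T. f w * c w) = (\<Sum>j<length bs. f (bs ! j) * x j)"
    "\<And>f. (\<Sum>w\<in>T. conjugate (c w) * f w) = (\<Sum>j<length bs. conjugate (x j) * f (bs ! j))"
proof -
  have bij: "bij_betw (nth bs) {..<length bs} (set bs)"
    using assms(2) by (intro bij_betw_nth) auto
  define c where "c w = (if w \<in> set bs then x (inv_into {..<length bs} (nth bs) w) else 0)" for w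
  have c: "c (bs ! j) = x j" if "j < length bs" for j
    using that bij unfolding c_def by (simp add: bij_betw_inv_into_left)
  have "(\<Sum>w\<in>T. f w * c w) = (\<Sum>w\<in>set bs. f w * c w)" for f
    by (rule sum.mono_neutral_right) (use assms in \<open>auto simp: c_def\<close>)
  then have 1: "(\<Sum>w\<in>T. f w * c w) = (\<Sum>j<length bs. f (bs ! j) * x j)" for f
    by (simp add: sum.reindex_bij_betw[OF bij, symmetric] c)
  have "(\<Sum>w\<in>T. conjugate (c w) * f w) = (\<Sum>w\<in>set bs. conjugate (c w) * f w)" for f
    by (rule sum.mono_neutral_right) (use assms in \<open>auto simp: c_def\<close>)
  then have 2: "(\<Sum>w\<in>T. conjugate (c w) * f w) = (\<Sum>j<length bs. conjugate (x j) * f (bs ! j))" for f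
    by (simp add: sum.reindex_bij_betw[OF bij, symmetric] c)
  show thesis by (rule that[OF 1 2])
qed

text \<open>The second part reaches all rows \<open>v\<close> in \<open>T\<close>, not just the
  listed ones. Independence of the full columns then makes the Gram form definite.\<close>

lemma matrix_psd_list:
  assumes "finite T" "matrix_psd T M" "distinct bs" "set bs \<subseteq> T"
  shows "0 \<le> (\<Sum>i<length bs. \<Sum>j<length bs. conjugate (x i) * M (bs ! i) (bs ! j) * x j)"
    and "(\<Sum>i<length bs. \<Sum>j<length bs. conjugate (x i) * M (bs ! i) (bs ! j) * x j) = 0 \<Longrightarrow>
      v \<in> T \<Longrightarrow> (\<Sum>j<length bs. M v (bs ! j) * x j) = 0"
proof -
  obtain c where c: "\<And>f. (\<Sum>w\<in>T. f w * c w) = (\<Sum>j<length bs. f (bs ! j) * x j)"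
    "\<And>f. (\<Sum>w\<in>T. conjugate (c w) * f w) = (\<Sum>j<length bs. conjugate (x j) * f (bs ! j))"
    using sum_list_support[OF assms(1,3,4)] by blast
  have eq: "(\<Sum>v\<in>T. \<Sum>w\<in>T. conjugate (c v) * M v w * c w)
      = (\<Sum>i<length bs. \<Sum>j<length bs. conjugate (x i) * M (bs ! i) (bs ! j) * x j)"
    by (simp add: mult.assoc c flip: sum_distrib_left)
  show "0 \<le> (\<Sum>i<length bs. \<Sum>j<length bs. conjugate (x i) * M (bs ! i) (bs ! j) * x j)"
    using assms(2) unfolding eq[symmetric] matrix_psd_def by blast
  show "(\<Sum>j<length bs. M v (bs ! j) * x j) = 0"
    if "(\<Sum>i<length bs. \<Sum>j<length bs. conjugate (x i) * M (bs ! i) (bs ! j) * x j) = 0" "v \<in> T"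
    using matrix_psd_kernel[OF assms(1,2) that(1)[folded eq] that(2)] by (simp add: c)
qed

section \<open>The truncated GNS construction\<close>

text \<open>The bound \<open>k - 1\<close> leaves room for one letter in front of a basis word,
  which is what the operators need. The gap \<open>d\<close> enters separately, with the
  constraints.\<close>

locale flat_moments =
  fixes k :: nat and y :: "'n::finite ncword \<Rightarrow> 'k::real_or_complex"
    and bs :: "'n ncword list" and J :: "'k vec \<Rightarrow> 'u"
  assumes psd: "matrix_psd (words k) (moment_matrix y)"
    and inj: "inj_on J (carrier_vec (length bs))"
    and k: "k \<ge> 1"
    and bs: "distinct bs" "set bs \<subseteq> words (k - 1)"
    and indep: "\<And>c. \<forall>v\<in>words k. (\<Sum>j<length bs. moment_matrix y v (bs ! j) * c j) = 0
      \<Longrightarrow> \<forall>j<length bs. c j = 0"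
    and span: "\<And>w. w \<in> words k \<Longrightarrow>
      \<exists>c. \<forall>v\<in>words k. moment_matrix y v w = (\<Sum>j<length bs. moment_matrix y v (bs ! j) * c j)"
begin

abbreviation r :: nat where "r \<equiv> length bs"

abbreviation M :: "'n ncword \<Rightarrow> 'n ncword \<Rightarrow> 'k" where "M \<equiv> moment_matrix y"

lemma M_hermitian: "\<lbrakk>v \<in> words k; w \<in> words k\<rbrakk> \<Longrightarrow> M v w = conjugate (M w v)"
  using psd unfolding matrix_psd_def by blast

text \<open>The Hankel-type structure of moment matrices. It gives both the adjoint relation and the
  compatibility of the operators with words outside the basis.\<close>

lemma M_shift: "M v (l # w) = M (letter_star l # v) w"
  by (simp add: moment_matrix_eq word_star_Cons)

lemma bs_nth: "j < r \<Longrightarrow> length (bs ! j) \<le> k - 1"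
  using subsetD[OF bs(2) nth_mem, of j] by (simp add: words_def)

lemma bs_words: "j < r \<Longrightarrow> bs ! j \<in> words k"
  and bs_Cons_words: "j < r \<Longrightarrow> l # bs ! j \<in> words k"
  using bs_nth[of j] k by (auto simp: words_def)

lemma set_bs_words: "set bs \<subseteq> words k"
  using bs(2) by (auto simp: words_def)

sublocale gram_space r "\<lambda>i j. M (bs ! i) (bs ! j)" J
proof (rule gram_space.intro)
  show "inj_on J (carrier_vec r)" by (rule inj)
  show "M (bs ! i) (bs ! j) = conjugate (M (bs ! j) (bs ! i))" if "i < r" "j < r" for i j
    by (rule M_hermitian[OF bs_words[OF that(1)] bs_words[OF that(2)]])
  fix x :: "'k vec" assume x: "x \<in> carrier_vec r"
  show "0 \<le> gram_form r (\<lambda>i j. M (bs ! i) (bs ! j)) x x"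
    unfolding gram_form_def by (rule matrix_psd_list(1)[OF finite_words psd bs(1) set_bs_words])
  assume "gram_form r (\<lambda>i j. M (bs ! i) (bs ! j)) x x = 0"
  from matrix_psd_list(2)[OF finite_words psd bs(1) set_bs_words this[unfolded gram_form_def]]
  have "\<forall>v\<in>words k. (\<Sum>j<r. M v (bs ! j) * x $ j) = 0" by blast
  then have "\<forall>j<r. x $ j = 0" by (rule indep)
  then show "x = 0\<^sub>v r" using x by (intro eq_vecI) auto
qed

text \<open>For words of length at most \<open>k\<close> such coefficients exist by
  \<open>span\<close> and are unique by \<open>indep\<close>.\<close>

definition word_coeff :: "'n ncword \<Rightarrow> nat \<Rightarrow> 'k" where
  "word_coeff w = (SOME c. \<forall>v\<in>words k. M v w = (\<Sum>j<r. M v (bs ! j) * c j))"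

definition word_coords :: "'n ncword \<Rightarrow> 'k vec" where
  "word_coords w = vec r (word_coeff w)"

lemma word_coords_carrier [simp]: "word_coords w \<in> carrier_vec r"
  by (simp add: word_coords_def)

lemma M_word_coords:
  assumes "v \<in> words k" "w \<in> words k"
  shows "M v w = (\<Sum>j<r. M v (bs ! j) * word_coords w $ j)"
proof -
  have "\<forall>v\<in>words k. M v w = (\<Sum>j<r. M v (bs ! j) * word_coeff w j)"
    unfolding word_coeff_def by (rule someI_ex[OF span[OF assms(2)]])
  from bspec[OF this assms(1)] show ?thesis
    by (rule trans) (intro sum.cong refl, simp add: word_coords_def)
qed

abbreviation word_vec :: "'n ncword \<Rightarrow> 'u" where "word_vec w \<equiv> J (word_coords w)"

lemma word_vec_carrier [simp]: "word_vec w \<in> J ` carrier_vec r"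
  by simp

lemma gram_form_right:
  assumes "w \<in> words k"
  shows "gram_form r (\<lambda>i j. M (bs ! i) (bs ! j)) x (word_coords w) = (\<Sum>i<r. conjugate (x $ i) * M (bs ! i) w)"
  unfolding gram_form_def
  by (intro sum.cong refl) (simp add: M_word_coords[OF bs_words assms] sum_distrib_left mult.assoc)

text \<open>The column of \<open>w\<close> is expanded in the right argument; hermitian symmetry
  then exchanges the arguments and the column of \<open>v\<close> is expanded. This extends the Gram
  identity from basis words to all words of length at most \<open>k\<close>.\<close>

lemma ip_word_vec:
  assumes v: "v \<in> words k" and w: "w \<in> words k"
  shows "ip gram_hilbert (word_vec v) (word_vec w) = M v w"
proof -
  have "ip gram_hilbert (word_vec v) (word_vec w) = (\<Sum>i<r. conjugate (word_coords v $ i) * M (bs ! i) w)"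
    using w by (simp add: gram_form_right)
  also have "\<dots> = conjugate (\<Sum>i<r. M w (bs ! i) * word_coords v $ i)"
    unfolding sum_conjugate[OF finite_lessThan] conjugate_dist_mul
    by (intro sum.cong refl) (use M_hermitian[OF bs_words w] in \<open>simp add: mult.commute\<close>)
  also have "\<dots> = M v w"
    by (simp only: M_word_coords[OF w v, symmetric] M_hermitian[OF v w, symmetric])
  finally show ?thesis .
qed

lemma word_coords_basis:
  assumes j: "j < r"
  shows "word_coords (bs ! j) = unit_vec r j"
proof -
  have "(\<Sum>i<r. M v (bs ! i) * (word_coords (bs ! j) $ i - unit_vec r j $ i)) = 0" if v: "v \<in> words k" for v
  proof -
    have "(\<Sum>i<r. M v (bs ! i) * unit_vec r j $ i) = (\<Sum>i<r. if i = j then M v (bs ! i) else 0)"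
      by (intro sum.cong refl) (use j in \<open>simp add: unit_vec_def\<close>)
    also have "\<dots> = M v (bs ! j)" using j by simp
    finally show ?thesis
      using M_word_coords[OF v bs_words[OF j]] by (simp add: right_diff_distrib sum_subtractf)
  qed
  then have "\<forall>i<r. word_coords (bs ! j) $ i - unit_vec r j $ i = 0"
    by (intro indep) blast
  then show ?thesis by (intro eq_vecI) (auto simp: word_coords_def)
qed

lemma ip_expand_left:
  assumes "u \<in> carrier gram_hilbert" "v \<in> carrier gram_hilbert"
  shows "ip gram_hilbert u v = (\<Sum>i<r. conjugate (coords u $ i) * ip gram_hilbert (word_vec (bs ! i)) v)"
proof -
  have "ip gram_hilbert (word_vec (bs ! i)) v = (\<Sum>j<r. M (bs ! i) (bs ! j) * coords v $ j)" if i: "i < r" for i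
    using i by (simp add: word_coords_basis gram_form_unit_left)
  then show ?thesis by (simp add: gram_form_def sum_distrib_left mult.assoc)
qed

lemma ip_expand_right:
  assumes u: "u \<in> carrier gram_hilbert" and v: "v \<in> carrier gram_hilbert"
  shows "ip gram_hilbert u v = (\<Sum>i<r. ip gram_hilbert u (word_vec (bs ! i)) * coords v $ i)"
proof -
  have "ip gram_hilbert u v = conjugate (ip gram_hilbert v u)"
    by (rule ip_conjugate[OF v u])
  also have "\<dots> = (\<Sum>i<r. conjugate (ip gram_hilbert (word_vec (bs ! i)) u) * coords v $ i)"
    unfolding ip_expand_left[OF v u] by (simp add: sum_conjugate conjugate_dist_mul mult.commute del: gram_hilbert_simps)
  also have "\<dots> = (\<Sum>i<r. ip gram_hilbert u (word_vec (bs ! i)) * coords v $ i)"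
    by (intro sum.cong refl arg_cong2[where f = "(*)"] ip_conjugate[symmetric] u) simp
  finally show ?thesis .
qed

section \<open>Left multiplication by letters\<close>

definition shift :: "'n letter \<Rightarrow> 'u \<Rightarrow> 'u" where
  "shift l = gram_op (\<lambda>i j. word_coords (l # bs ! j) $ i)"

text \<open>The Gram matrix times the matrix of \<open>shift l\<close> has entries
  \<open>M (bs ! i) (l # bs ! m)\<close>, because column \<open>m\<close> of the second factor holds
  the coordinates of the word \<open>l # bs ! m\<close>.\<close>

lemma ip_shift:
  "gram_form r (\<lambda>i j. M (bs ! i) (bs ! j)) x (coords (shift l u))
     = (\<Sum>i<r. \<Sum>m<r. conjugate (x $ i) * M (bs ! i) (l # bs ! m) * coords u $ m)"
proof -
  have "(\<Sum>j<r. M (bs ! i) (bs ! j) * coords (shift l u) $ j) = (\<Sum>m<r. M (bs ! i) (l # bs ! m) * coords u $ m)"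
    if i: "i < r" for i
  proof -
    have "(\<Sum>j<r. M (bs ! i) (bs ! j) * coords (shift l u) $ j)
        = (\<Sum>j<r. \<Sum>m<r. M (bs ! i) (bs ! j) * word_coords (l # bs ! m) $ j * coords u $ m)"
      by (simp add: shift_def sum_distrib_left mult.assoc)
    also have "\<dots> = (\<Sum>m<r. (\<Sum>j<r. M (bs ! i) (bs ! j) * word_coords (l # bs ! m) $ j) * coords u $ m)"
      by (subst sum.swap) (simp add: sum_distrib_right)
    also have "\<dots> = (\<Sum>m<r. M (bs ! i) (l # bs ! m) * coords u $ m)"
      by (simp add: M_word_coords[OF bs_words[OF i] bs_Cons_words])
    finally show ?thesis .
  qed
  then show ?thesis by (simp add: gram_form_def mult.assoc flip: sum_distrib_left)
qed

text \<open>By \<open>M_shift\<close> and hermitian symmetry, the matrices in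
  \<open>ip_shift\<close> for \<open>l\<close> and for \<open>letter_star l\<close> are conjugate
  transposes of each other.\<close>

lemma shift_adjoint:
  assumes u: "u \<in> carrier gram_hilbert" and v: "v \<in> carrier gram_hilbert"
  shows "ip gram_hilbert u (shift l v) = ip gram_hilbert (shift (letter_star l) u) v"
proof -
  have "ip gram_hilbert (shift (letter_star l) u) v = conjugate (ip gram_hilbert v (shift (letter_star l) u))"
    by (rule ip_conjugate) (use u v in \<open>auto simp: shift_def\<close>)
  also have "\<dots> = (\<Sum>m<r. \<Sum>i<r. coords v $ m * conjugate (M (bs ! m) (letter_star l # bs ! i)) * conjugate (coords u $ i))"
    by (simp add: ip_shift sum_conjugate conjugate_dist_mul)
  also have "\<dots> = (\<Sum>i<r. \<Sum>m<r. conjugate (coords u $ i) * M (letter_star l # bs ! i) (bs ! m) * coords v $ m)"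
    by (subst sum.swap) (intro sum.cong refl, simp add: M_hermitian[OF bs_Cons_words bs_words] ac_simps)
  also have "\<dots> = ip gram_hilbert u (shift l v)"
    by (simp add: ip_shift M_shift)
  finally show ?thesis ..
qed

text \<open>The definition covers basis words only. For general \<open>w\<close>, its column
  relation read on the rows \<open>letter_star l # bs ! i\<close>, which still have length at most
  \<open>k\<close>, is a relation for \<open>l # w\<close> on the rows \<open>bs ! i\<close>, and
  these rows determine a vector.\<close>

lemma shift_word_vec:
  assumes w: "l # w \<in> words k"
  shows "shift l (word_vec w) = word_vec (l # w)"
proof (rule hilbert_eqI)
  have w': "w \<in> words k" using w by (simp add: words_def)
  fix u assume u: "u \<in> carrier gram_hilbert"
  have "(\<Sum>m<r. M (bs ! i) (l # bs ! m) * word_coords w $ m) = M (bs ! i) (l # w)" if "i < r" for i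
    using M_word_coords[OF bs_Cons_words[OF that, of "letter_star l"] w'] by (simp add: M_shift)
  then have "ip gram_hilbert u (shift l (word_vec w)) = (\<Sum>i<r. conjugate (coords u $ i) * M (bs ! i) (l # w))"
    by (simp add: ip_shift mult.assoc flip: sum_distrib_left)
  then show "ip gram_hilbert u (shift l (word_vec w)) = ip gram_hilbert u (word_vec (l # w))"
    by (simp add: gram_form_right[OF w])
qed (auto simp: shift_def)

definition gns_op :: "'n \<Rightarrow> 'u \<Rightarrow> 'u" where
  "gns_op i = shift (Var i)"

lemma gns_op_bounded: "bounded_operator gram_hilbert (gns_op i)"
  unfolding gns_op_def shift_def by (rule gram_op_bounded)

lemma letter_op_gns:
  assumes u: "u \<in> carrier gram_hilbert"
  shows "letter_op gram_hilbert gns_op l u = shift l u"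
proof (cases l)
  case (Var i)
  then show ?thesis by (simp add: gns_op_def)
next
  case (VarStar i)
  have "adjoint_op gram_hilbert (gns_op i) u = shift (VarStar i) u"
    by (rule adjoint_op_unique[OF gns_op_bounded u])
      (use shift_adjoint[OF u, of _ "Var i"] in \<open>auto simp: gns_op_def shift_def\<close>)
  then show ?thesis using VarStar by simp
qed

lemma word_op_gns: "w @ v \<in> words k \<Longrightarrow> word_op gram_hilbert gns_op w (word_vec v) = word_vec (w @ v)"
proof (induction w)
  case (Cons l w)
  then have "w @ v \<in> words k" by (simp add: words_def)
  then show ?case
    using Cons by (simp add: word_op_Cons letter_op_gns shift_word_vec)
qed simp

lemmas gns_word_op_closed = word_op_closed[of gns_op, OF gns_op_bounded]

text \<open>The operator of \<open>w\<close> cannot be applied to \<open>b\<close> directly when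
  \<open>w @ b\<close> is longer than \<open>k\<close>. A prefix of \<open>w\<close> is therefore
  moved to the left argument, where it appears starred.\<close>

lemma ip_word_op_gns:
  assumes len: "length a + length w + length b \<le> 2 * k" "length a \<le> k" "length b \<le> k"
  shows "ip gram_hilbert (word_vec a) (word_op gram_hilbert gns_op w (word_vec b)) = y (word_star a @ w @ b)"
proof -
  \<comment> \<open>The prefix fills the left word up to length \<open>k\<close> as far as
    \<open>w\<close> allows. The rest together with \<open>b\<close> then has length at most
    \<open>k\<close>, by the bound on the total length or, if nothing remains, by that on
    \<open>b\<close>.\<close>
  define w1 where "w1 = take (k - length a) w"
  define w2 where "w2 = drop (k - length a) w"
  have w: "w = w1 @ w2" by (simp add: w1_def w2_def)
  have 1: "word_star w1 @ a \<in> words k" and 2: "w2 @ b \<in> words k"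
    using len by (auto simp: w1_def w2_def words_def)
  have "ip gram_hilbert (word_vec a) (word_op gram_hilbert gns_op w (word_vec b))
      = ip gram_hilbert (word_op gram_hilbert gns_op (word_star w1) (word_vec a)) (word_vec (w2 @ b))"
    unfolding w word_op_append word_op_gns[OF 2]
    by (rule ip_word_op[of gns_op, OF gns_op_bounded]) auto
  also have "\<dots> = M (word_star w1 @ a) (w2 @ b)"
    unfolding word_op_gns[OF 1] by (rule ip_word_vec[OF 1 2])
  also have "\<dots> = y (word_star a @ w @ b)"
    by (simp add: moment_matrix_eq word_star_append w)
  finally show ?thesis .
qed

text \<open>Two basis words with a word of length at most \<open>2 * j\<close> between them have
  total length at most \<open>2 * k\<close>, so every inner product involved is a moment and they
  assemble into the localizing matrix.\<close>

lemma ip_poly_op_gns: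
  assumes len: "\<And>w. w \<in> Poly_Mapping.keys q \<Longrightarrow> length w \<le> 2 * j"
    and bs_len: "\<And>i. i < r \<Longrightarrow> length (bs ! i) + j \<le> k"
    and u: "u \<in> carrier gram_hilbert" and v: "v \<in> carrier gram_hilbert"
  shows "ip gram_hilbert u (poly_op gram_hilbert gns_op q v) =
    (\<Sum>i<r. \<Sum>m<r. conjugate (coords u $ i) * localizing_matrix q y (bs ! i) (bs ! m) * coords v $ m)"
proof -
  have word: "ip gram_hilbert u (word_op gram_hilbert gns_op w v) =
      (\<Sum>i<r. \<Sum>m<r. conjugate (coords u $ i) * y (word_star (bs ! i) @ w @ bs ! m) * coords v $ m)"
    if w: "w \<in> Poly_Mapping.keys q" for w
  proof -
    have "ip gram_hilbert (word_vec (bs ! i)) (word_op gram_hilbert gns_op w v)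
        = (\<Sum>m<r. y (word_star (bs ! i) @ w @ bs ! m) * coords v $ m)" if i: "i < r" for i
    proof -
      \<comment> \<open>The word operator is moved to the left, \<open>v\<close> is expanded in the
        basis, and the operator is moved back; this replaces linearity of word operators.\<close>
      have "ip gram_hilbert (word_vec (bs ! i)) (word_op gram_hilbert gns_op w v)
          = ip gram_hilbert (word_op gram_hilbert gns_op (word_star w) (word_vec (bs ! i))) v"
        by (rule ip_word_op[of gns_op, OF gns_op_bounded]) (use v in auto)
      also have "\<dots> = (\<Sum>m<r. ip gram_hilbert (word_op gram_hilbert gns_op (word_star w) (word_vec (bs ! i)))
          (word_vec (bs ! m)) * coords v $ m)"
        by (rule ip_expand_right) (use v gns_word_op_closed in auto)
      also have "\<dots> = (\<Sum>m<r. ip gram_hilbert (word_vec (bs ! i)) (word_op gram_hilbert gns_op w (word_vec (bs ! m)))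
          * coords v $ m)"
        by (intro sum.cong refl arg_cong2[where f = "(*)"] ip_word_op[of gns_op, OF gns_op_bounded, symmetric]) auto
      also have "\<dots> = (\<Sum>m<r. y (word_star (bs ! i) @ w @ bs ! m) * coords v $ m)"
      proof (intro sum.cong refl arg_cong2[where f = "(*)"] ip_word_op_gns)
        fix m assume "m \<in> {..<r}"
        then show "length (bs ! i) + length w + length (bs ! m) \<le> 2 * k" "length (bs ! i) \<le> k" "length (bs ! m) \<le> k"
          using bs_len[OF i] bs_len[of m] len[OF w] by auto
      qed
      finally show ?thesis .
    qed
    then show ?thesis
      using ip_expand_left[OF u gns_word_op_closed[OF v]]
      by (simp add: sum_distrib_left mult.assoc del: gram_hilbert_simps)
  qed
  have "ip gram_hilbert u (poly_op gram_hilbert gns_op q v) =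
      (\<Sum>w\<in>Poly_Mapping.keys q. Poly_Mapping.lookup q w *
        (\<Sum>i<r. \<Sum>m<r. conjugate (coords u $ i) * y (word_star (bs ! i) @ w @ bs ! m) * coords v $ m))"
    unfolding ip_poly_op[of gns_op, OF gns_op_bounded u v] by (intro sum.cong refl) (simp only: word)
  also have "\<dots> = (\<Sum>i<r. \<Sum>w\<in>Poly_Mapping.keys q. \<Sum>m<r. conjugate (coords u $ i) *
      (Poly_Mapping.lookup q w * y (word_star (bs ! i) @ w @ bs ! m)) * coords v $ m)"
    unfolding sum_distrib_left by (subst sum.swap) (simp add: ac_simps)
  also have "\<dots> = (\<Sum>i<r. \<Sum>m<r. conjugate (coords u $ i) * localizing_matrix q y (bs ! i) (bs ! m) * coords v $ m)"
    by (intro sum.cong refl, subst sum.swap)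
      (simp add: localizing_matrix_eq sum_distrib_left sum_distrib_right)
  finally show ?thesis .
qed

text \<open>\<open>j\<close> controls which moments occur, \<open>i\<close> is the order of the
  localizing matrix. They are separate because the common bound \<open>d\<close> is used for lengths
  while each constraint has its own order.\<close>

lemma positive_op_gns:
  assumes len: "\<And>w. w \<in> Poly_Mapping.keys q \<Longrightarrow> length w \<le> 2 * j"
    and bs_len: "\<And>i. i < r \<Longrightarrow> length (bs ! i) + j \<le> k"
    and psd_q: "matrix_psd (words i) (localizing_matrix q y)" and bs_i: "set bs \<subseteq> words i"
  shows "positive_op gram_hilbert (poly_op gram_hilbert gns_op q)"
  unfolding positive_op_def
proof (intro conjI ballI)
  have eq: "ip gram_hilbert u (poly_op gram_hilbert gns_op q v) =
      (\<Sum>a<r. \<Sum>b<r. conjugate (coords u $ a) * localizing_matrix q y (bs ! a) (bs ! b) * coords v $ b)"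
    if "u \<in> carrier gram_hilbert" "v \<in> carrier gram_hilbert" for u v
    using len bs_len that by (rule ip_poly_op_gns)
  fix u assume u: "u \<in> carrier gram_hilbert"
  show "0 \<le> ip gram_hilbert u (poly_op gram_hilbert gns_op q u)"
    unfolding eq[OF u u] by (rule matrix_psd_list(1)[OF finite_words psd_q bs(1) bs_i])
  fix v assume v: "v \<in> carrier gram_hilbert"
  have herm: "localizing_matrix q y (bs ! a) (bs ! b) = conjugate (localizing_matrix q y (bs ! b) (bs ! a))"
    if "a < r" "b < r" for a b
    using psd_q subsetD[OF bs_i nth_mem[OF that(1)]] subsetD[OF bs_i nth_mem[OF that(2)]]
    unfolding matrix_psd_def by blast
  have "ip gram_hilbert (poly_op gram_hilbert gns_op q u) v = conjugate (ip gram_hilbert v (poly_op gram_hilbert gns_op q u))"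
    by (rule ip_conjugate[OF v poly_op_closed[of gns_op, OF gns_op_bounded u]])
  also have "\<dots> = (\<Sum>a<r. \<Sum>b<r. coords v $ a * conjugate (localizing_matrix q y (bs ! a) (bs ! b)) * conjugate (coords u $ b))"
    by (simp add: eq[OF v u] sum_conjugate conjugate_dist_mul del: gram_hilbert_simps)
  also have "\<dots> = (\<Sum>b<r. \<Sum>a<r. conjugate (coords u $ b) * localizing_matrix q y (bs ! b) (bs ! a) * coords v $ a)"
    by (subst sum.swap) (intro sum.cong refl, simp add: herm[symmetric] ac_simps)
  also have "\<dots> = ip gram_hilbert u (poly_op gram_hilbert gns_op q v)"
    by (simp add: eq[OF u v] del: gram_hilbert_simps)
  finally show "ip gram_hilbert u (poly_op gram_hilbert gns_op q v) = ip gram_hilbert (poly_op gram_hilbert gns_op q u) v" ..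
qed

text \<open>With the empty word on both sides the whole length \<open>2 * k\<close> is available to
  the words of \<open>p\<close>.\<close>

lemma gns_objective:
  assumes "\<And>w. w \<in> Poly_Mapping.keys p \<Longrightarrow> length w \<le> 2 * k"
  shows "ip gram_hilbert (word_vec []) (poly_op gram_hilbert gns_op p (word_vec [])) = riesz y p"
proof -
  have c: "word_vec [] \<in> carrier gram_hilbert" by simp
  show ?thesis
    unfolding ip_poly_op[of gns_op, OF gns_op_bounded c c] riesz_def
    by (intro sum.cong refl arg_cong2[where f = "(*)"], subst ip_word_op_gns) (use assms in auto)
qed

end

section \<open>Cardinalities and degrees\<close>

lemma real_times_real_lepoll: "(UNIV :: (real \<times> real) set) \<lesssim> (UNIV :: real set)"
  using card_of_Times_same_infinite[of "UNIV :: real set"] infinite_UNIV_char_0[where 'a = real]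
  by (simp add: eqpoll_imp_lepoll eqpoll_iff_card_of_ordIso)

text \<open>In either case of \<open>real_or_complex_cases\<close> two reals suffice to describe a
  scalar.\<close>

lemma scalar_lepoll_real: "(UNIV :: 'k::real_or_complex set) \<lesssim> (UNIV :: real set)"
proof -
  have "\<exists>g :: real \<times> real \<Rightarrow> 'k. UNIV \<subseteq> range g"
    using real_or_complex_cases[where 'a = 'k]
  proof
    assume "\<forall>z::'k. conjugate z = z \<and> z = of_real (real_part z)"
    then show ?thesis by (intro exI[of _ "\<lambda>(a, b). of_real a"]) (auto simp: image_def)
  next
    assume "\<exists>i::'k. i * i = -1 \<and> conjugate i = - i \<and> (\<forall>z. \<exists>a b. z = of_real a + of_real b * i)"
    then obtain i :: 'k where "\<forall>z. \<exists>a b. z = of_real a + of_real b * i" by blast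
    then show ?thesis by (intro exI[of _ "\<lambda>(a, b). of_real a + of_real b * i"]) (auto simp: image_def)
  qed
  then have "(UNIV :: 'k set) \<lesssim> (UNIV :: (real \<times> real) set)"
    unfolding lepoll_iff by blast
  then show ?thesis by (rule lepoll_trans[OF _ real_times_real_lepoll])
qed

text \<open>The source of the injection \<open>J\<close>: coordinate spaces of every finite
  dimension fit into any type at least as large as the reals.\<close>

lemma carrier_vec_lepoll_real: "(carrier_vec n :: 'k::real_or_complex vec set) \<lesssim> (UNIV :: real set)"
proof (induction n)
  case 0
  have "(carrier_vec 0 :: 'k vec set) = {0\<^sub>v 0}" by auto
  then show ?case by (auto simp: lepoll_def inj_on_def)
next
  case (Suc n)
  have "carrier_vec (Suc n) \<subseteq> (\<lambda>(a, x). vCons a x) ` (UNIV \<times> carrier_vec n :: ('k \<times> 'k vec) set)"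
  proof
    fix x :: "'k vec" assume "x \<in> carrier_vec (Suc n)"
    then show "x \<in> (\<lambda>(a, x). vCons a x) ` (UNIV \<times> carrier_vec n)"
      by (cases x) auto
  qed
  then have "(carrier_vec (Suc n) :: 'k vec set) \<lesssim> (UNIV \<times> carrier_vec n :: ('k \<times> 'k vec) set)"
    by (rule subset_image_lepoll)
  also have "(UNIV \<times> carrier_vec n :: ('k \<times> 'k vec) set) \<lesssim> (UNIV \<times> UNIV :: (real \<times> real) set)"
    by (rule times_lepoll_mono[OF scalar_lepoll_real Suc.IH])
  also have "(UNIV \<times> UNIV :: (real \<times> real) set) \<lesssim> (UNIV :: real set)"
    using real_times_real_lepoll by simp
  finally show ?case .
qed

lemma length_le_ncdegree: "w \<in> Poly_Mapping.keys p \<Longrightarrow> length w \<le> ncdegree p"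
  unfolding ncdegree_def by (intro Max_ge) auto

lemma ncdegree_le_half_degree: "ncdegree p \<le> 2 * half_degree p"
  unfolding half_degree_def by linarith

lemma half_degree_le: "ncdegree p \<le> 2 * k \<Longrightarrow> half_degree p \<le> k"
  unfolding half_degree_def by linarith

theorem theorem2:
  fixes p :: "('n::finite, 'k::real_or_complex) ncpoly"
    and q :: "nat \<Rightarrow> ('n, 'k) ncpoly"
    and m k d :: nat
    and y :: "'n ncword \<Rightarrow> 'k"
  assumes universe: "(UNIV :: real set) \<lesssim> (UNIV :: 'u set)"
    and "hermitian p"
    and "\<forall>i\<in>{1..m}. hermitian (q i)"
    and "\<exists>(H :: ('k, 'u) hilbert) X \<phi>. problem_feasible m q H X \<phi>"
    and "archimedean m q"
    and "m \<ge> 1"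
    and "d = Max ((\<lambda>i. half_degree (q i)) ` {1..m})"
    and "d \<ge> 1"
    and "2 * k \<ge> max (ncdegree p) (Max ((\<lambda>i. ncdegree (q i)) ` {1..m}))"
    and "relaxation_optimal k m q p y"
    and "matrix_rank (words k) (moment_matrix y) = matrix_rank (words (k - d)) (moment_matrix y)"
  shows "relaxation_value k m q p = problem_value TYPE('u) m q p \<and>
    (\<exists>(H :: ('k, 'u) hilbert) X \<phi>.
       global_optimizer m q p H X \<phi> \<and>
       vectorspace.fin_dim class_ring H \<and>
       vectorspace.dim class_ring H = matrix_rank (words (k - d)) (moment_matrix y))"
proof -
  have hd: "half_degree (q i) \<le> d" if "i \<in> {1..m}" for i
    using that \<open>d = Max _\<close> by simp
  have degk: "ncdegree p \<le> 2 * k" "\<And>i. i \<in> {1..m} \<Longrightarrow> ncdegree (q i) \<le> 2 * k"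
    using \<open>2 * k \<ge> _\<close> by (auto intro: order_trans[OF Max_ge])
  \<comment> \<open>As the set is nonempty, \<open>d\<close> is the half-degree of one of the
    constraints, hence at most \<open>k\<close>, and \<open>k - d\<close> is a true
    difference.\<close>
  have "d \<in> (\<lambda>i. half_degree (q i)) ` {1..m}"
    using Max_in[of "(\<lambda>i. half_degree (q i)) ` {1..m}"] \<open>d = Max _\<close> \<open>m \<ge> 1\<close> by auto
  then have dk: "d \<le> k"
    using degk(2) by (auto intro: half_degree_le)
  have feas: "relaxation_feasible k m q y" and opt: "ereal (real_part (riesz y p)) = relaxation_value k m q p"
    using \<open>relaxation_optimal k m q p y\<close> by (auto simp: relaxation_optimal_def)
  have sub: "words (k - d) \<subseteq> (words k :: 'n ncword set)" by (auto simp: words_def)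
  obtain bs where basis: "distinct bs" "set bs \<subseteq> words (k - d)"
      "length bs = matrix_rank (words (k - d)) (moment_matrix y)"
    and indep: "\<And>c. \<forall>v\<in>words k. (\<Sum>j<length bs. moment_matrix y v (bs ! j) * c j) = 0
      \<Longrightarrow> \<forall>j<length bs. c j = 0"
    and span: "\<And>w. w \<in> words k \<Longrightarrow>
      \<exists>c. \<forall>v\<in>words k. moment_matrix y v w = (\<Sum>j<length bs. moment_matrix y v (bs ! j) * c j)"
    using flat_matrix_basis_list[OF finite_words sub \<open>matrix_rank (words k) _ = _\<close>] by blast
  obtain J :: "'k vec \<Rightarrow> 'u" where inj: "inj_on J (carrier_vec (length bs))"
    using lepoll_trans[OF carrier_vec_lepoll_real[of "length bs"] universe] unfolding lepoll_def by blast
  interpret flat_moments k y bs J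
  proof (rule flat_moments.intro)
    show "matrix_psd (words k) (moment_matrix y)" using feas by (simp add: relaxation_feasible_def)
    show "k \<ge> 1" using dk \<open>d \<ge> 1\<close> by simp
    \<comment> \<open>Here \<open>d \<ge> 1\<close> provides the spare letter.\<close>
    show "set bs \<subseteq> words (k - 1)" using basis(2) \<open>d \<ge> 1\<close> by (auto simp: words_def)
  qed (fact inj basis(1) indep span)+
  have bs_len: "length (bs ! i) + d \<le> k" if "i < r" for i
    using subsetD[OF basis(2) nth_mem[OF that]] dk by (simp add: words_def)
  have "positive_op gram_hilbert (poly_op gram_hilbert gns_op (q i))" if i: "i \<in> {1..m}" for i
  proof (rule positive_op_gns)
    show "length w \<le> 2 * d" if "w \<in> Poly_Mapping.keys (q i)" for w
      using length_le_ncdegree[OF that] ncdegree_le_half_degree[of "q i"] hd[OF i] by linarith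
    show "matrix_psd (words (k - half_degree (q i))) (localizing_matrix (q i) y)"
      using feas i by (simp add: relaxation_feasible_def)
    show "set bs \<subseteq> words (k - half_degree (q i))"
      using basis(2) hd[OF i] by (auto simp: words_def)
  qed (rule bs_len)
  moreover have "hnorm gram_hilbert (word_vec []) = 1"
  proof -
    have "ip gram_hilbert (word_vec []) (word_vec []) = 1"
      using ip_word_vec[of "[]" "[]"] feas by (simp add: words_def moment_matrix_eq relaxation_feasible_def)
    then show ?thesis using real_part_of_real[of 1] unfolding hnorm_def by simp
  qed
  ultimately have gns_feas: "problem_feasible m q gram_hilbert gns_op (word_vec [])"
    unfolding problem_feasible_def using hilbert_space_axioms gns_op_bounded by simp
  have obj: "problem_objective p gram_hilbert gns_op (word_vec []) = real_part (riesz y p)"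
    unfolding problem_objective_def
    by (subst gns_objective) (use length_le_ncdegree degk(1) order_trans in blast, rule refl)
  \<comment> \<open>The constructed triple attains the relaxation value, which is already a lower
    bound for the problem; this closes the circle of inequalities.\<close>
  have "problem_value TYPE('u) m q p \<le> ereal (problem_objective p gram_hilbert gns_op (word_vec []))"
    unfolding problem_value_def by (rule INF_lower2[of "(gram_hilbert, gns_op, word_vec [])"]) (use gns_feas in auto)
  then have value_eq: "relaxation_value k m q p = problem_value TYPE('u) m q p"
    using relaxation_value_le_problem_value[where 'u = 'u, of k m q p] opt obj by simp
  then have "global_optimizer m q p gram_hilbert gns_op (word_vec [])"
    unfolding global_optimizer_def obj using gns_feas opt by simp
  then show ?thesis
    using value_eq gram_dim basis(3) by metis
qed

end
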